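(* Let $f\colon\mathbb{R}^d\to\mathbb{R}$ be convex and differentiable with a locally Lipschitz gradient $\nabla f$, and let $g\colon\mathbb{R}^d\to(-\infty,+\infty]$ be convex and lower semicontinuous. Let $F=f+g$, suppose that the problem $\min_x F(x)$ has a solution, and write $F_*=\min F$. Then the sequence $(x^k)$ generated by the adaptive proximal gradient method described in the context converges to a solution of $\min_x F(x)$, and $$\min_{1\le i\le k}\bigl(F(x^i)-F_*\bigr)\le\frac{R^2}{2\sum_{i=1}^k\alpha_i},$$ where, for a solution $x^*$, $$R^2=\|x^0-x^*\|^2+2\alpha_0^2\|\widetilde\nabla F(x^0)\|^2+\alpha_0\,(F(x^0)-F_* ).$$ In particular, if $\alpha_0$ satisfies $\alpha_0L_1\in\left[\frac1{\sqrt2},2\right]$, then $$\min_{1\le i\le k}\bigl(F(x^i)-F_*\bigr)\le\frac{LR^2}{\sqrt2\,k},$$ where $L$ is the Lipschitz constant of $\nabla f$ over the ball $B(x^*,R)$ with center $x^*$ and radius $R$.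
   Context: $\|\cdot\|$ is the Euclidean norm, $[t]_+=\max\{t,0\}$, $\operatorname{dom}g=\{x:g(x)<+\infty\}$, $\partial g$ is the convex subdifferential, and $\operatorname{prox}_{\alpha g}=(\mathrm{Id}+\alpha\,\partial g)^{-1}$. A map is locally Lipschitz if it is Lipschitz over any compact set of its domain. Algorithm (adaptive proximal gradient method): given $x^0\in\operatorname{dom}g$, $\theta_0=\frac13$, $\alpha_0>0$, set $x^1=\operatorname{prox}_{\alpha_0g}(x^0-\alpha_0\nabla f(x^0))$, and for $k=1,2,\dots$ $$L_k=\frac{\|\nabla f(x^k)-\nabla f(x^{k-1})\|}{\|x^k-x^{k-1}\|},\qquad \alpha_k=\min\left\{\sqrt{\tfrac23+\theta_{k-1}}\;\alpha_{k-1},\ \frac{\alpha_{k-1}}{\sqrt{[2\alpha_{k-1}^2L_k^2-1]_+}}\right\},$$ $$x^{k+1}=\operatorname{prox}_{\alpha_kg}(x^k-\alpha_k\nabla f(x^k)),\qquad \theta_k=\frac{\alpha_k}{\alpha_{k-1}},$$ with the convention $\frac a0=+\infty$ for $a>0$. Notation: $\widetilde\nabla F(x^k)=\nabla f(x^k)+\widetilde\nabla g(x^k)$, where $\widetilde\nabla g(x^k)\in\partial g(x^k)$ is a certain subgradient of $g$ at $x^k$; for the points produced by the proximal step it is the one for which $x^{k+1}=x^k-\alpha_k(\nabla f(x^k)+\widetilde\nabla g(x^{k+1}))$. *)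

theory Defs
  imports "HOL-Analysis.Analysis"
begin

definition edom :: "('a \<Rightarrow> ereal) \<Rightarrow> 'a set"
  where "edom g = {x. g x < \<infinity>}"

(* For u = 0 or v = 0 the product 0 * \<infinity> is 0 in ereal, so the inequality is trivial there. *)
definition econvex :: "('a::real_vector \<Rightarrow> ereal) \<Rightarrow> bool"
  where "econvex g \<longleftrightarrow>
    (\<forall>x y u v. 0 \<le> u \<and> 0 \<le> v \<and> u + v = 1 \<longrightarrow>
       g (u *\<^sub>R x + v *\<^sub>R y) \<le> ereal u * g x + ereal v * g y)"

definition lower_semicontinuous :: "('a::topological_space \<Rightarrow> ereal) \<Rightarrow> bool"
  where "lower_semicontinuous g \<longleftrightarrow> (\<forall>x. g x \<le> Liminf (at x) g)"

definition locally_Lipschitz :: "('a::metric_space \<Rightarrow> 'b::metric_space) \<Rightarrow> bool"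
  where "locally_Lipschitz h \<longleftrightarrow> (\<forall>K. compact K \<longrightarrow> (\<exists>L. L-lipschitz_on K h))"

definition subdiff :: "('a::real_inner \<Rightarrow> ereal) \<Rightarrow> 'a \<Rightarrow> 'a set"
  where "subdiff g x = {v. x \<in> edom g \<and> (\<forall>y. g x + ereal (v \<bullet> (y - x)) \<le> g y)}"

(* The resolvent (Id + \<alpha> \<partial>g)^{-1}. It is single-valued and everywhere defined when \<alpha> > 0 and
   g is proper, convex and lower semicontinuous. *)
definition prox :: "real \<Rightarrow> ('a::real_inner \<Rightarrow> ereal) \<Rightarrow> 'a \<Rightarrow> 'a"
  where "prox \<alpha> g z = (THE p. \<exists>u\<in>subdiff g p. z = p + \<alpha> *\<^sub>R u)"

(* If x k = x (k - 1), the quotient is 0 / 0 = 0; in that case x k is a fixed point of the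
   proximal step, hence a solution, and the sequence is constant from there on. *)
definition lip_est :: "('a::real_normed_vector \<Rightarrow> 'a) \<Rightarrow> (nat \<Rightarrow> 'a) \<Rightarrow> nat \<Rightarrow> real"
  where "lip_est gradf x k = norm (gradf (x k) - gradf (x (k - 1))) / norm (x k - x (k - 1))"

(* The step size rule is an equation in ereal, where a / 0 = \<infinity> for a > 0. *)
definition adaptive_prox_grad ::
  "('a::real_inner \<Rightarrow> 'a) \<Rightarrow> ('a \<Rightarrow> ereal) \<Rightarrow> (nat \<Rightarrow> 'a) \<Rightarrow> (nat \<Rightarrow> real) \<Rightarrow> (nat \<Rightarrow> real) \<Rightarrow> bool"
  where "adaptive_prox_grad gradf g x \<alpha> \<theta> \<longleftrightarrow>
    x 0 \<in> edom g \<and> \<theta> 0 = 1/3 \<and> \<alpha> 0 > 0 \<and>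
    x 1 = prox (\<alpha> 0) g (x 0 - \<alpha> 0 *\<^sub>R gradf (x 0)) \<and>
    (\<forall>k\<ge>1.
       ereal (\<alpha> k) =
         min (ereal (sqrt (2/3 + \<theta> (k - 1)) * \<alpha> (k - 1)))
             (ereal (\<alpha> (k - 1)) /
              ereal (sqrt (max (2 * (\<alpha> (k - 1))\<^sup>2 * (lip_est gradf x k)\<^sup>2 - 1) 0))) \<and>
       x (k + 1) = prox (\<alpha> k) g (x k - \<alpha> k *\<^sub>R gradf (x k)) \<and>
       \<theta> k = \<alpha> k / \<alpha> (k - 1))"

end

theory Submission
  imports Defs
begin

text \<open>Write \<open>D k = gradf (x k) + u k\<close> with \<open>u k\<close> the subgradient of \<open>g\<close> selected at \<open>x k\<close>. The two
  bounds in the step size rule are exactly what makes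
  \<open>\<parallel>x (k+1) - s\<parallel>\<^sup>2 + (\<alpha> k)\<^sup>2 \<parallel>D k\<parallel>\<^sup>2 + \<alpha> k (2 + 3 \<theta> k) (F (x k) - F s)\<close> nonincreasing for every solution
  \<open>s\<close>; summing up gives the bound with \<open>\<Sum> \<alpha> i\<close>. A step that is not at least \<open>1 / (\<surd>2 L)\<close> can only
  follow a much larger one, so these steps are at least \<open>1 / (\<surd>2 L)\<close> on average.

  For convergence, the decrease of the energy also controls the Bregman distances of \<open>f\<close> at \<open>s\<close>, so
  \<open>gradf (x k)\<close> tends to \<open>gradf s\<close>, and the differences \<open>u k - u (k+1)\<close>, so \<open>(x k - x (k+1)) / \<alpha> k\<close>
  varies slowly; since \<open>x\<close> is bounded, this quotient tends to 0. Hence \<open>D k\<close> tends to 0 and every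
  cluster point is a solution. The part of the energy besides \<open>\<parallel>x (k+1) - s\<parallel>\<^sup>2\<close> is the same for all
  solutions \<open>s\<close>, so two cluster points have to coincide, as in Opial's lemma.\<close>

section \<open>Gradients and subgradients of convex functions\<close>

lemma GDERIV_directional_limit:
  assumes "GDERIV f y :> w"
  shows "((\<lambda>t. (f (y + t *\<^sub>R d) - f y) / t) \<longlongrightarrow> w \<bullet> d) (at_right 0)"
proof -
  have "(f has_derivative (\<lambda>h. h \<bullet> w)) (at (y + 0 *\<^sub>R d))"
    using assms by (simp add: gderiv_def)
  moreover have "((\<lambda>t. y + t *\<^sub>R d) has_derivative (\<lambda>t. t *\<^sub>R d)) (at 0)"
    by (auto intro!: derivative_eq_intros)
  ultimately have "((\<lambda>t. f (y + t *\<^sub>R d)) has_derivative (\<lambda>t. (t *\<^sub>R d) \<bullet> w)) (at 0)"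
    using has_derivative_compose by blast
  then have "((\<lambda>t. f (y + t *\<^sub>R d)) has_real_derivative (w \<bullet> d)) (at 0)"
    by (simp add: has_field_derivative_def inner_commute mult_commute_abs)
  then have "((\<lambda>t. (f (y + t *\<^sub>R d) - f y) / t) \<longlongrightarrow> w \<bullet> d) (at 0)"
    by (simp add: has_field_derivative_iff)
  then show ?thesis
    by (rule tendsto_mono[rotated]) (simp add: at_le)
qed

lemma convex_on_above_gradient:
  assumes cvx: "convex_on UNIV f" and der: "GDERIV f y :> w"
  shows "f y + w \<bullet> (z - y) \<le> f z"
proof -
  have "\<forall>\<^sub>F t in at_right 0. (f (y + t *\<^sub>R (z - y)) - f y) / t \<le> f z - f y"
    unfolding eventually_at_right_field
  proof (intro exI[of _ 1] conjI allI impI)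
    fix t :: real assume t: "0 < t" "t < 1"
    have "f ((1 - t) *\<^sub>R y + t *\<^sub>R z) \<le> (1 - t) * f y + t * f z"
      using convex_onD[OF cvx, of t y z] t by simp
    moreover have "(1 - t) *\<^sub>R y + t *\<^sub>R z = y + t *\<^sub>R (z - y)" by (simp add: algebra_simps)
    ultimately have "f (y + t *\<^sub>R (z - y)) - f y \<le> (f z - f y) * t" by (simp add: algebra_simps)
    then show "(f (y + t *\<^sub>R (z - y)) - f y) / t \<le> f z - f y" using t by (simp add: divide_le_eq)
  qed simp
  then have "w \<bullet> (z - y) \<le> f z - f y"
    by (intro tendsto_upperbound[OF GDERIV_directional_limit[OF der]]) auto
  then show ?thesis by simp
qed

text \<open>The tangent plane at \<open>y\<close> lies below \<open>f\<close> and touches it again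
  at \<open>s\<close>. Along the difference \<open>d\<close> of the gradients, \<open>f\<close> must
  rise from \<open>s\<close> at least as fast as this plane, which leaves
  \<open>d \<bullet> d \<le> 0\<close>. This turns vanishing Bregman distances into equality of
  gradients.\<close>

lemma convex_tangent_gradient_eq:
  assumes cvx: "convex_on UNIV f" and der: "\<And>y. GDERIV f y :> gradf y"
    and eq: "f s = f y + gradf y \<bullet> (s - y)"
  shows "gradf s = gradf y"
proof -
  define d where "d = gradf y - gradf s"
  have "\<forall>\<^sub>F t in at_right 0. gradf y \<bullet> d \<le> (f (s + t *\<^sub>R d) - f s) / t"
    unfolding eventually_at_right_field
  proof (intro exI[of _ 1] conjI allI impI)
    fix t :: real assume t: "0 < t"
    have "f y + gradf y \<bullet> (s + t *\<^sub>R d - y) \<le> f (s + t *\<^sub>R d)"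
      by (rule convex_on_above_gradient[OF cvx der])
    then have "(gradf y \<bullet> d) * t \<le> f (s + t *\<^sub>R d) - f s"
      using eq by (simp add: inner_diff_right inner_add_right algebra_simps)
    then show "gradf y \<bullet> d \<le> (f (s + t *\<^sub>R d) - f s) / t" using t by (simp add: le_divide_eq)
  qed simp
  then have "gradf y \<bullet> d \<le> gradf s \<bullet> d"
    by (intro tendsto_lowerbound[OF GDERIV_directional_limit[OF der]]) auto
  then have "d \<bullet> d \<le> 0" by (simp add: d_def inner_diff_left)
  then have "d = 0" by (metis inner_eq_zero_iff inner_ge_zero order_antisym)
  then show ?thesis by (simp add: d_def)
qed

lemma subdiff_real_ineq:
  assumes "\<And>y. g y \<noteq> -\<infinity>" "w \<in> subdiff g a" "b \<in> edom g"
  shows "real_of_ereal (g a) + w \<bullet> (b - a) \<le> real_of_ereal (g b)"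
proof -
  have "g a + ereal (w \<bullet> (b - a)) \<le> g b" "a \<in> edom g"
    using assms(2) by (auto simp: subdiff_def)
  then show ?thesis
    using assms(1)[of a] assms(1)[of b] assms(3)
    by (cases "g a"; cases "g b") (auto simp: edom_def)
qed

text \<open>Fermat's rule for a differentiable plus a convex function: compare \<open>p\<close> with
  points of the segment to \<open>y\<close> and let them tend to \<open>p\<close>. It serves for the
  quadratic in \<open>prox_exists\<close> and for \<open>f\<close> at a solution.\<close>

lemma minimizer_subdiff:
  assumes proper: "\<And>y. g y \<noteq> -\<infinity>" and cvx: "econvex g"
    and der: "GDERIV h p :> w" and dom: "p \<in> edom g"
    and min: "\<And>y. ereal (h p) + g p \<le> ereal (h y) + g y"
  shows "- w \<in> subdiff g p"
proof -
  obtain a where a: "g p = ereal a"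
    using dom proper[of p] by (cases "g p") (auto simp: edom_def)
  have "g p + ereal (- w \<bullet> (y - p)) \<le> g y" for y
  proof (cases "g y")
    case (real b)
    have "\<forall>\<^sub>F t in at_right 0. a - b \<le> (h (p + t *\<^sub>R (y - p)) - h p) / t"
      unfolding eventually_at_right_field
    proof (intro exI[of _ 1] conjI allI impI)
      fix t :: real assume t: "0 < t" "t < 1"
      have "g ((1 - t) *\<^sub>R p + t *\<^sub>R y) \<le> ereal (1 - t) * g p + ereal t * g y"
        using cvx t unfolding econvex_def by auto
      moreover have "(1 - t) *\<^sub>R p + t *\<^sub>R y = p + t *\<^sub>R (y - p)" by (simp add: algebra_simps)
      ultimately have le: "g (p + t *\<^sub>R (y - p)) \<le> ereal ((1 - t) * a + t * b)"
        using a real by simp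
      have "ereal (h p) + g p \<le> ereal (h (p + t *\<^sub>R (y - p))) + g (p + t *\<^sub>R (y - p))" by (rule min)
      also have "\<dots> \<le> ereal (h (p + t *\<^sub>R (y - p))) + ereal ((1 - t) * a + t * b)"
        using le by (rule add_left_mono)
      finally have "h p + a \<le> h (p + t *\<^sub>R (y - p)) + (1 - t) * a + t * b" using a by simp
      then have "(a - b) * t \<le> h (p + t *\<^sub>R (y - p)) - h p" by (simp add: algebra_simps)
      then show "a - b \<le> (h (p + t *\<^sub>R (y - p)) - h p) / t" using t by (simp add: le_divide_eq)
    qed simp
    then have "a - b \<le> w \<bullet> (y - p)"
      by (intro tendsto_lowerbound[OF GDERIV_directional_limit[OF der]]) auto
    then show ?thesis using a real by simp
  qed (use proper[of y] in auto)
  then show ?thesis using dom by (simp add: subdiff_def)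
qed

section \<open>Lower semicontinuity and the proximal map\<close>

lemma lower_semicontinuous_limit_le:
  fixes g :: "'a::first_countable_topology \<Rightarrow> ereal"
  assumes lsc: "lower_semicontinuous g" and lim: "y \<longlonglongrightarrow> l" and c: "c \<longlonglongrightarrow> c0"
    and le: "\<And>n. g (y n) \<le> ereal (c n)"
  shows "g l \<le> ereal c0"
proof (rule ccontr)
  assume "\<not> g l \<le> ereal c0"
  then obtain b where b: "ereal c0 < b" "b < g l" using dense[of "ereal c0" "g l"] by (auto simp: not_le)
  have "b < Liminf (at l) g" using lsc b by (auto simp: lower_semicontinuous_def intro: less_le_trans)
  then have "\<forall>\<^sub>F z in at l. b < g z" by (rule less_LiminfD)
  \<comment> \<open>\<open>Liminf (at l) g\<close> looks at punctured neighbourhoods only;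
    \<open>b < g l\<close> covers indices with \<open>y n = l\<close>.\<close>
  then have "\<forall>\<^sub>F z in nhds l. b < g z" using b by (simp add: eventually_nhds_conv_at)
  then have "\<forall>\<^sub>F n in sequentially. b < g (y n)" 
    using lim eventually_compose_filterlim by blast
  moreover have "\<forall>\<^sub>F n in sequentially. ereal (c n) < b"
    using c b(1) by (intro order_tendstoD(2)[of "\<lambda>n. ereal (c n)" "ereal c0"]) auto
  ultimately have "\<forall>\<^sub>F n in sequentially. False"
    by eventually_elim (metis le leD less_trans)
  then show False by simp
qed

text \<open>Direct method for \<open>q + g\<close>, whose minimizers are resolvent points by
  Fermat's rule. The subgradient \<open>w\<close> yields an affine minorant of \<open>g\<close>, and
  the quadratic \<open>q\<close> outgrows it, so sublevel sets are bounded and the infimum is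
  finite.\<close>

lemma prox_exists:
  fixes g :: "'a::euclidean_space \<Rightarrow> ereal"
  assumes proper: "\<And>y. g y \<noteq> -\<infinity>" and cvx: "econvex g" and lsc: "lower_semicontinuous g"
    and sub: "w \<in> subdiff g s" and pos: "\<alpha> > 0"
  shows "\<exists>p. \<exists>u\<in>subdiff g p. z = p + \<alpha> *\<^sub>R u"
proof -
  define q where "q y = (norm (y - z))\<^sup>2 / (2 * \<alpha>)" for y
  define \<phi> where "\<phi> y = ereal (q y) + g y" for y
  obtain a where a: "g s = ereal a"
    using sub proper[of s] by (cases "g s") (auto simp: edom_def subdiff_def)
  define b where "b = a + w \<bullet> (z - s)"
  have minor: "ereal (b + w \<bullet> (y - z)) \<le> g y" for y
  proof -
    have "g s + ereal (w \<bullet> (y - s)) \<le> g y" using sub by (simp add: subdiff_def)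
    then show ?thesis by (simp add: a b_def inner_diff_right)
  qed
  have bound: "norm (y - z) \<le> 1 + 2 * \<alpha> * (norm w + \<bar>c - b\<bar>)" if "\<phi> y \<le> ereal c" for y c
  proof -
    let ?r = "norm (y - z)"
    have "ereal (q y + (b + w \<bullet> (y - z))) \<le> \<phi> y"
      unfolding \<phi>_def using minor[of y] by (metis add_left_mono plus_ereal.simps(1))
    then have "q y + (b + w \<bullet> (y - z)) \<le> c" using that order_trans by fastforce
    moreover have "- (w \<bullet> (y - z)) \<le> norm w * ?r"
      by (metis Cauchy_Schwarz_ineq2 abs_le_D2)
    ultimately have *: "?r\<^sup>2 / (2 * \<alpha>) \<le> norm w * ?r + \<bar>c - b\<bar>" unfolding q_def by linarith
    show ?thesis
    proof (cases "?r \<le> 1")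
      case True
      moreover have "0 \<le> 2 * \<alpha> * (norm w + \<bar>c - b\<bar>)" using pos by simp
      ultimately show ?thesis by linarith
    next
      case False
      then have "\<bar>c - b\<bar> \<le> \<bar>c - b\<bar> * ?r" by (simp add: mult_le_cancel_left1)
      then have "?r\<^sup>2 / (2 * \<alpha>) \<le> (norm w + \<bar>c - b\<bar>) * ?r" using * by (simp add: algebra_simps)
      then have "?r * ?r \<le> (2 * \<alpha> * (norm w + \<bar>c - b\<bar>)) * ?r"
        using pos by (simp add: divide_le_eq power2_eq_square mult_ac)
      then have "?r \<le> 2 * \<alpha> * (norm w + \<bar>c - b\<bar>)"
        by (rule mult_right_le_imp_le) (use False in linarith)
      then show ?thesis by simp
    qed
  qed
  have low: "ereal (b - (norm w)\<^sup>2 * \<alpha>) \<le> \<phi> y" for y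
  proof -
    have "ereal (q y + (b + w \<bullet> (y - z))) \<le> \<phi> y"
      unfolding \<phi>_def using minor[of y] by (metis add_left_mono plus_ereal.simps(1))
    moreover have "- (norm w * norm (y - z)) \<le> w \<bullet> (y - z)"
      using Cauchy_Schwarz_ineq2[of w "y - z"] by linarith
    moreover have "norm w * norm (y - z) \<le> q y + (norm w)\<^sup>2 * \<alpha>"
    proof -
      \<comment> \<open>Half of \<open>q y\<close> completes the square with the linear term; the
        other half is the second summand.\<close>
      have "0 \<le> (norm (y - z) / 2 - norm w * \<alpha>)\<^sup>2 / \<alpha> + (norm (y-z))\<^sup>2 / (4 * \<alpha>)" using pos by simp
      also have "\<dots> = q y + (norm w)\<^sup>2 * \<alpha> - norm w * norm (y - z)"
        using pos unfolding q_def by (simp add: field_simps power2_eq_square)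
      finally show ?thesis by simp
    qed
    ultimately have "b - (norm w)\<^sup>2 * \<alpha> \<le> q y + (b + w \<bullet> (y - z))" by linarith
    then show ?thesis using \<open>ereal (q y + (b + w \<bullet> (y - z))) \<le> \<phi> y\<close>
      by (meson ereal_less_eq(3) order_trans)
  qed
  have "ereal (b - (norm w)\<^sup>2 * \<alpha>) \<le> (INF y. \<phi> y)" by (rule INF_greatest) (rule low)
  moreover have "(INF y. \<phi> y) \<le> \<phi> s" by (rule INF_lower) simp
  moreover have "\<phi> s = ereal (q s + a)" by (simp add: \<phi>_def a)
  ultimately obtain m where m: "(INF y. \<phi> y) = ereal m" by (cases "INF y. \<phi> y") auto
  have "\<exists>y. \<phi> y \<le> ereal (m + 1 / real (Suc n))" for n
  proof -
    have "(INF y. \<phi> y) < ereal (m + 1 / real (Suc n))" using m by simp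
    then show ?thesis by (auto simp: INF_less_iff intro: less_imp_le)
  qed
  then obtain y where y: "\<And>n. \<phi> (y n) \<le> ereal (m + 1 / real (Suc n))" by metis
  have "\<phi> (y n) \<le> ereal (m + 1)" for n
    using y[of n] by (rule order_trans) simp
  then have "range y \<subseteq> cball z (1 + 2 * \<alpha> * (norm w + \<bar>m + 1 - b\<bar>))"
    using bound by (force simp: dist_norm norm_minus_commute)
  then obtain p r where pr: "strict_mono (r::nat \<Rightarrow> nat)" "(y \<circ> r) \<longlonglongrightarrow> p"
    using compact_cball[of z "1 + 2 * \<alpha> * (norm w + \<bar>m + 1 - b\<bar>)"]
    unfolding compact_def by (metis range_subsetD)
  have "g ((y \<circ> r) n) \<le> ereal (m + 1 / real (Suc (r n)) - q ((y \<circ> r) n))" for n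
    using y[of "r n"] unfolding \<phi>_def by (cases "g (y (r n))") auto
  moreover have "(\<lambda>n. m + 1 / real (Suc (r n)) - q ((y \<circ> r) n)) \<longlonglongrightarrow> m + 0 - q p"
  proof -
    have "(\<lambda>n. 1 / real (Suc (r n))) \<longlonglongrightarrow> 0"
      using LIMSEQ_subseq_LIMSEQ[OF lim_1_over_n[THEN LIMSEQ_Suc] pr(1)] by (simp add: o_def)
    moreover have "(\<lambda>n. y (r n)) \<longlonglongrightarrow> p" using pr(2) by (simp add: o_def)
    ultimately show ?thesis unfolding q_def o_def
      by (intro tendsto_intros) (use pos in auto)
  qed
  ultimately have "g p \<le> ereal (m + 0 - q p)"
    using lower_semicontinuous_limit_le[OF lsc pr(2)] by blast
  then have pm: "\<phi> p \<le> ereal m" and dom: "p \<in> edom g"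
    unfolding \<phi>_def using proper[of p] by (cases "g p"; auto simp: edom_def)+
  have "GDERIV q p :> ((p - z) /\<^sub>R \<alpha>)"
    unfolding gderiv_def q_def power2_norm_eq_inner using pos
    by (auto intro!: derivative_eq_intros simp: inner_commute inner_diff_left inner_diff_right field_simps)
  moreover have "ereal (q p) + g p \<le> ereal (q y) + g y" for y
    using pm m INF_lower[of y UNIV \<phi>] unfolding \<phi>_def by (metis UNIV_I order_trans)
  ultimately have "- ((p - z) /\<^sub>R \<alpha>) \<in> subdiff g p"
    using minimizer_subdiff[OF proper cvx _ dom] by blast
  moreover have "z = p + \<alpha> *\<^sub>R (- ((p - z) /\<^sub>R \<alpha>))" using pos by simp
  ultimately show ?thesis by blast
qed

text \<open>Monotonicity of the subdifferential makes the resolvent single-valued, so the definite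
  description in \<open>prox\<close> denotes the point that \<open>prox_exists\<close>
  provides.\<close>

lemma prox_subdiff:
  fixes g :: "'a::euclidean_space \<Rightarrow> ereal"
  assumes proper: "\<And>y. g y \<noteq> -\<infinity>" and cvx: "econvex g" and lsc: "lower_semicontinuous g"
    and sub: "w \<in> subdiff g s" and pos: "\<alpha> > 0"
  shows "(z - prox \<alpha> g z) /\<^sub>R \<alpha> \<in> subdiff g (prox \<alpha> g z)"
proof -
  have unique: "p = q"
    if "u \<in> subdiff g p" "z = p + \<alpha> *\<^sub>R u" "v \<in> subdiff g q" "z = q + \<alpha> *\<^sub>R v" for p q u v
  proof -
    have dom: "p \<in> edom g" "q \<in> edom g" using that by (auto simp: subdiff_def)
    have "u \<bullet> (q - p) + v \<bullet> (p - q) \<le> 0"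
      using subdiff_real_ineq[OF proper that(1) dom(2)] subdiff_real_ineq[OF proper that(3) dom(1)]
      by linarith
    then have "(v - u) \<bullet> (p - q) \<le> 0" by (simp add: inner_diff_left inner_diff_right)
    moreover have "p - q = \<alpha> *\<^sub>R (v - u)" using that by (simp add: algebra_simps)
    ultimately have "\<alpha> * ((v - u) \<bullet> (v - u)) \<le> 0" by simp
    then have "(v - u) \<bullet> (v - u) \<le> 0" using pos by (simp add: mult_le_0_iff)
    then have "v - u = 0" by (metis inner_eq_zero_iff inner_ge_zero order_antisym)
    then show ?thesis using \<open>p - q = \<alpha> *\<^sub>R (v - u)\<close> by simp
  qed
  have "\<exists>!p. \<exists>u\<in>subdiff g p. z = p + \<alpha> *\<^sub>R u"
    using prox_exists[OF proper cvx lsc sub pos, of z] unique by blast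
  from theI'[OF this] obtain u where u: "u \<in> subdiff g (prox \<alpha> g z)" "z = prox \<alpha> g z + \<alpha> *\<^sub>R u"
    unfolding prox_def by blast
  then have "(z - prox \<alpha> g z) /\<^sub>R \<alpha> = u" using pos
    by (metis add_diff_cancel_left' scaleR_scaleR left_inverse scaleR_one less_irrefl)
  then show ?thesis using u(1) by simp
qed

section \<open>Limits of bounded sequences\<close>

text \<open>A subsequence of \<open>z\<close> staying away from \<open>c\<close> could be thinned
  out until \<open>y\<close> converges along it. Compactness is available for \<open>y\<close>,
  while the limit is wanted for a derived sequence such as \<open>gradf (x k)\<close>.\<close>

lemma bounded_cluster_limit:
  fixes y :: "nat \<Rightarrow> 'a::heine_borel" and z :: "nat \<Rightarrow> 'b::metric_space"
  assumes bdd: "bounded (range y)"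
    and cl: "\<And>r l. strict_mono r \<Longrightarrow> (y \<circ> r) \<longlonglongrightarrow> l \<Longrightarrow> (z \<circ> r) \<longlonglongrightarrow> c"
  shows "z \<longlonglongrightarrow> c"
proof (rule ccontr)
  assume "\<not> z \<longlonglongrightarrow> c"
  then obtain e where e: "e > 0" "\<And>N. \<exists>n\<ge>N. \<not> dist (z n) c < e"
    unfolding lim_sequentially by metis
  then have "infinite {n. \<not> dist (z n) c < e}"
    unfolding infinite_nat_iff_unbounded_le by auto
  then obtain r :: "nat \<Rightarrow> nat" where r: "strict_mono r" "\<And>n. \<not> dist (z (r n)) c < e"
    using infinite_enumerate by blast
  have "bounded (range (y \<circ> r))" using bdd by (rule bounded_subset) auto
  then obtain l r' where r': "strict_mono (r'::nat\<Rightarrow>nat)" "((y \<circ> r) \<circ> r') \<longlonglongrightarrow> l"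
    using bounded_imp_convergent_subsequence by blast
  then have "(z \<circ> (r \<circ> r')) \<longlonglongrightarrow> c"
    using cl[OF strict_mono_o[OF r(1) r'(1)]] by (simp add: o_assoc)
  then obtain n where "dist ((z \<circ> (r \<circ> r')) n) c < e"
    using e(1) unfolding lim_sequentially by blast
  then show False using r(2) by simp
qed

text \<open>A bounded sequence cannot drift: slowly varying increments p have to vanish, since
  many consecutive steps in nearly the same direction would add up.\<close>
lemma slowly_varying_increment_tendsto_0:
  fixes x p :: "nat \<Rightarrow> 'a::real_inner"
  assumes bdd: "\<And>k. norm (x k - s) \<le> r"
    and step: "\<And>k. x (Suc k) = x k - \<alpha> k *\<^sub>R p k"
    and low: "\<And>k. m \<le> \<alpha> k" and m: "m > 0"
    and diff: "(\<lambda>k. p (Suc k) - p k) \<longlonglongrightarrow> 0"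
  shows "p \<longlonglongrightarrow> 0"
proof (rule LIMSEQ_I)
  fix e :: real assume e: "e > 0"
  \<comment> \<open>\<open>N\<close> steps, each advancing by at least \<open>m * e / 2\<close> in
    the direction of \<open>p k\<close>, exceed the diameter \<open>2 * r\<close>.\<close>
  obtain N :: nat where N: "4 * r / (m * e) < real N" using reals_Archimedean2 by blast
  have r: "0 \<le> r" using bdd[of 0] norm_ge_zero order_trans by blast
  then have Npos: "N > 0" using N m e by (metis divide_nonneg_pos mult_pos_pos mult_nonneg_nonneg
        gr0I of_nat_0 not_less zero_le_numeral)
  \<comment> \<open>Over \<open>N\<close> steps \<open>p\<close> changes by at most
    \<open>e / 2\<close>, so it keeps at least half of its component along
    \<open>p k\<close>.\<close>
  define \<delta> where "\<delta> = e / (2 * real N)"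
  have "\<delta> > 0" using e Npos by (simp add: \<delta>_def)
  then obtain K where K: "\<And>k. k \<ge> K \<Longrightarrow> norm (p (Suc k) - p k) < \<delta>"
    using LIMSEQ_D[OF diff] by auto
  have "norm (p k) < e" if k: "k \<ge> K" for k
  proof (rule ccontr)
    assume "\<not> norm (p k) < e"
    then have ge: "e \<le> norm (p k)" by simp
    have near: "norm (p (k + j) - p k) \<le> real j * \<delta>" for j
    proof (induction j)
      case (Suc j)
      have "norm (p (k + Suc j) - p k) \<le> norm (p (Suc (k + j)) - p (k + j)) + norm (p (k + j) - p k)"
        by (metis add_Suc_right norm_triangle_ineq diff_add_cancel add_diff_eq)
      also have "\<dots> \<le> \<delta> + real j * \<delta>" using K[of "k + j"] k Suc by fastforce
      finally show ?case by (simp add: algebra_simps)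
    qed simp
    have dir: "(norm (p k))\<^sup>2 / 2 \<le> p (k + j) \<bullet> p k" if "j < N" for j
    proof -
      have "real j * \<delta> \<le> real N * \<delta>" using that \<open>\<delta> > 0\<close> by simp
      also have "\<dots> = e / 2" using Npos by (simp add: \<delta>_def)
      finally have "norm (p (k + j) - p k) \<le> norm (p k) / 2" using near[of j] ge by linarith
      then have "norm (p (k + j) - p k) * norm (p k) \<le> norm (p k) / 2 * norm (p k)"
        by (rule mult_right_mono) simp
      moreover have "- ((p (k + j) - p k) \<bullet> p k) \<le> norm (p (k + j) - p k) * norm (p k)"
        by (metis Cauchy_Schwarz_ineq2 abs_le_D2)
      ultimately show ?thesis
        by (simp add: inner_diff_left power2_norm_eq_inner flip: power2_eq_square)
    qed
    have "real j * (m * (norm (p k))\<^sup>2 / 2) \<le> (x k - x (k + j)) \<bullet> p k" if "j \<le> N" for j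
      using that
    proof (induction j)
      case (Suc j)
      have "m * ((norm (p k))\<^sup>2 / 2) \<le> \<alpha> (k + j) * (p (k + j) \<bullet> p k)"
        using dir[of j] Suc.prems low[of "k + j"] m by (intro mult_mono) auto
      moreover have "(x k - x (k + Suc j)) \<bullet> p k
          = (x k - x (k + j)) \<bullet> p k + \<alpha> (k + j) * (p (k + j) \<bullet> p k)"
        by (simp add: step inner_diff_left)
      moreover have "real (Suc j) * (m * (norm (p k))\<^sup>2 / 2)
          = real j * (m * (norm (p k))\<^sup>2 / 2) + m * ((norm (p k))\<^sup>2 / 2)"
        by (simp add: distrib_right)
      ultimately show ?case using Suc by linarith
    qed simp
    from this[of N] have "real N * (m * (norm (p k))\<^sup>2 / 2) \<le> (x k - x (k + N)) \<bullet> p k" by simp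
    also have "\<dots> \<le> norm (x k - x (k + N)) * norm (p k)" by (rule norm_cauchy_schwarz)
    also have "\<dots> \<le> (2 * r) * norm (p k)"
    proof (rule mult_right_mono)
      have "norm (x k - x (k + N)) \<le> norm (x k - s) + norm (x (k + N) - s)"
        by (metis norm_triangle_ineq4 diff_diff_eq2 diff_add_cancel)
      then show "norm (x k - x (k + N)) \<le> 2 * r" using bdd[of k] bdd[of "k + N"] by linarith
    qed simp
    finally have "(real N * m * norm (p k)) * norm (p k) \<le> (4 * r) * norm (p k)"
      by (simp add: power2_eq_square)
    then have "real N * m * norm (p k) \<le> 4 * r" 
      by (rule mult_right_le_imp_le) (use ge e in linarith)
    moreover have "real N * m * e \<le> real N * m * norm (p k)" using ge m by (intro mult_left_mono) auto
    moreover have "4 * r < real N * m * e" using N m e by (simp add: divide_less_eq mult_ac)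
    ultimately show False by linarith
  qed
  then show "\<exists>K. \<forall>k\<ge>K. norm (p k - 0) < e" by auto
qed


section \<open>The step size recursion\<close>

text \<open>\<open>l k\<close> plays the role of the Lipschitz estimate with index
  \<open>k + 1\<close>. It is arbitrary here and \<open>\<theta> 0\<close> is any positive number,
  so that the tail of the algorithm from index 1 on is an instance as well.\<close>

locale adaptive_steps =
  fixes \<alpha> \<theta> l :: "nat \<Rightarrow> real"
  assumes \<alpha>_0: "\<alpha> 0 > 0" and \<theta>_0: "\<theta> 0 > 0"
    and \<theta>_Suc: "\<And>k. \<theta> (Suc k) = \<alpha> (Suc k) / \<alpha> k"
    and \<alpha>_Suc: "\<And>k. ereal (\<alpha> (Suc k)) = min (ereal (sqrt (2/3 + \<theta> k) * \<alpha> k))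
      (ereal (\<alpha> k) / ereal (sqrt (max (2 * (\<alpha> k)\<^sup>2 * (l k)\<^sup>2 - 1) 0)))"
begin

text \<open>If the bracket is not positive, the second term of the minimum is a quotient by 0, hence
  infinite. Each case also records the bound coming from the other term.\<close>

lemma step_cases:
  assumes "\<alpha> k > 0"
  obtains (growth) "\<alpha> (Suc k) = sqrt (2/3 + \<theta> k) * \<alpha> k"
      "2 * (\<alpha> k)\<^sup>2 * (l k)\<^sup>2 - 1 \<le> 0 \<or> \<alpha> (Suc k) \<le> \<alpha> k / sqrt (2 * (\<alpha> k)\<^sup>2 * (l k)\<^sup>2 - 1)"
  | (curvature) "2 * (\<alpha> k)\<^sup>2 * (l k)\<^sup>2 - 1 > 0" "\<alpha> (Suc k) = \<alpha> k / sqrt (2 * (\<alpha> k)\<^sup>2 * (l k)\<^sup>2 - 1)"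
      "\<alpha> (Suc k) \<le> sqrt (2/3 + \<theta> k) * \<alpha> k"
proof (cases "2 * (\<alpha> k)\<^sup>2 * (l k)\<^sup>2 - 1 \<le> 0")
  case True
  then have "ereal (\<alpha> (Suc k)) = ereal (sqrt (2/3 + \<theta> k) * \<alpha> k)"
    using \<alpha>_Suc[of k] assms by (simp add: max_def divide_ereal_def min_def)
  then show ?thesis using growth True by simp
next
  case False
  then have "ereal (\<alpha> (Suc k)) = ereal (min (sqrt (2/3 + \<theta> k) * \<alpha> k) (\<alpha> k / sqrt (2 * (\<alpha> k)\<^sup>2 * (l k)\<^sup>2 - 1)))"
    using \<alpha>_Suc[of k] by (simp add: max_def min_def)
  then have "\<alpha> (Suc k) = min (sqrt (2/3 + \<theta> k) * \<alpha> k) (\<alpha> k / sqrt (2 * (\<alpha> k)\<^sup>2 * (l k)\<^sup>2 - 1))"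
    by (simp only: ereal.inject)
  then show ?thesis using growth curvature False by (auto simp: min_def split: if_splits)
qed

lemma pos: "\<alpha> k > 0 \<and> \<theta> k > 0"
proof (induction k)
  case (Suc k)
  then have a: "\<alpha> k > 0" "\<theta> k > 0" by auto
  have "\<alpha> (Suc k) > 0"
    by (rule step_cases[OF a(1)]) (use a in auto)
  then show ?case using a by (simp add: \<theta>_Suc)
qed (use \<alpha>_0 \<theta>_0 in simp)

lemma \<alpha>_pos [simp]: "\<alpha> k > 0" and \<theta>_pos [simp]: "\<theta> k > 0"
  using pos by auto

lemma steps_nonneg [simp]: "0 \<le> \<alpha> k" "0 \<le> \<theta> k" "\<alpha> k \<noteq> 0"
  by (meson pos less_imp_le, meson pos less_imp_le, metis pos less_irrefl)

text \<open>Square the first bound of the step size rule and divide by \<open>\<alpha> k\<close>.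
  This makes the coefficient of the objective gap in \<open>energy_step\<close> nonnegative.\<close>

lemma growth_bound: "3 * \<alpha> (Suc k) * \<theta> (Suc k) \<le> \<alpha> k * (2 + 3 * \<theta> k)"
proof -
  have "\<alpha> (Suc k) \<le> sqrt (2/3 + \<theta> k) * \<alpha> k"
    by (rule step_cases[OF \<alpha>_pos, of k]) auto
  then have "(\<alpha> (Suc k))\<^sup>2 \<le> (sqrt (2/3 + \<theta> k) * \<alpha> k)\<^sup>2"
    by (rule power_mono) (simp add: less_imp_le)
  also have "\<dots> = (2/3 + \<theta> k) * (\<alpha> k)\<^sup>2" by (simp add: power_mult_distrib add_nonneg_nonneg less_imp_le)
  finally have "3 * (\<alpha> (Suc k))\<^sup>2 \<le> (2 + 3 * \<theta> k) * \<alpha> k * \<alpha> k"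
    by (simp add: algebra_simps power2_eq_square)
  then show ?thesis
    by (simp add: \<theta>_Suc divide_le_eq power2_eq_square mult_ac)
qed

text \<open>Squaring and clearing the denominator gives a form of the second bound that covers a
  nonpositive bracket too. It controls the coefficient of \<open>p \<bullet> p\<close> in
  \<open>next_gradient_bound\<close>.\<close>

lemma curvature_bound: "(\<alpha> (Suc k))\<^sup>2 * (2 * (\<alpha> k)\<^sup>2 * (l k)\<^sup>2 - 1) \<le> (\<alpha> k)\<^sup>2"
proof (cases "2 * (\<alpha> k)\<^sup>2 * (l k)\<^sup>2 - 1 \<le> 0")
  case True
  then have "(\<alpha> (Suc k))\<^sup>2 * (2 * (\<alpha> k)\<^sup>2 * (l k)\<^sup>2 - 1) \<le> 0" by (simp add: mult_nonneg_nonpos)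
  then show ?thesis by (smt (verit) zero_le_power2)
next
  case False
  define s where "s = 2 * (\<alpha> k)\<^sup>2 * (l k)\<^sup>2 - 1"
  have s: "s > 0" using False by (simp add: s_def)
  have "\<alpha> (Suc k) \<le> \<alpha> k / sqrt s"
    by (rule step_cases[OF \<alpha>_pos, of k]) (use s in \<open>auto simp: s_def\<close>)
  then have "\<alpha> (Suc k) * sqrt s \<le> \<alpha> k" using s by (simp add: le_divide_eq)
  then have "(\<alpha> (Suc k) * sqrt s)\<^sup>2 \<le> (\<alpha> k)\<^sup>2" by (rule power_mono) (simp add: s less_imp_le)
  then show ?thesis using s by (simp add: power_mult_distrib s_def)
qed

text \<open>Since \<open>2 * c\<^sup>2 * L\<^sup>2 = 1\<close>, the bracket \<open>s\<close>
  satisfies \<open>c\<^sup>2 * (s + 1) \<le> (\<alpha> k)\<^sup>2\<close>, so dividing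
  \<open>\<alpha> k\<close> by \<open>sqrt s\<close> leaves at least \<open>c\<close>. A ratio below
  1/3 means \<open>s > 9\<close>, which forces \<open>3 * c \<le> \<alpha> k\<close>.\<close>

lemma growth_or_large:
  assumes "\<bar>l k\<bar> \<le> L" "L > 0" and c: "c = 1 / (sqrt 2 * L)"
  obtains (growth) "\<alpha> (Suc k) = sqrt (2/3 + \<theta> k) * \<alpha> k" "\<theta> (Suc k) = sqrt (2/3 + \<theta> k)"
  | (large) "c \<le> \<alpha> (Suc k)" "1/3 \<le> \<theta> (Suc k) \<or> 3 * c \<le> \<alpha> k"
proof (rule step_cases[OF \<alpha>_pos, of k])
  assume "\<alpha> (Suc k) = sqrt (2/3 + \<theta> k) * \<alpha> k"
  then show ?thesis using growth \<alpha>_pos[of k] by (simp add: \<theta>_Suc)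
next
  define s where "s = 2 * (\<alpha> k)\<^sup>2 * (l k)\<^sup>2 - 1"
  assume "2 * (\<alpha> k)\<^sup>2 * (l k)\<^sup>2 - 1 > 0" "\<alpha> (Suc k) = \<alpha> k / sqrt (2 * (\<alpha> k)\<^sup>2 * (l k)\<^sup>2 - 1)"
  then have s: "s > 0" and eq: "\<alpha> (Suc k) = \<alpha> k / sqrt s" by (simp_all add: s_def)
  have cpos: "c > 0" using assms by simp
  have cL: "2 * c\<^sup>2 * L\<^sup>2 = 1" using assms by (simp add: power_mult_distrib power_divide)
  have "(l k)\<^sup>2 \<le> L\<^sup>2" using assms(1) by (metis abs_ge_zero power_mono power2_abs)
  then have "2 * (\<alpha> k)\<^sup>2 * (l k)\<^sup>2 \<le> 2 * (\<alpha> k)\<^sup>2 * L\<^sup>2" by (intro mult_left_mono) auto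
  then have "s + 1 \<le> 2 * (\<alpha> k)\<^sup>2 * L\<^sup>2" by (simp add: s_def)
  then have "c\<^sup>2 * (s + 1) \<le> c\<^sup>2 * (2 * (\<alpha> k)\<^sup>2 * L\<^sup>2)" by (intro mult_left_mono) auto
  also have "\<dots> = (\<alpha> k)\<^sup>2 * (2 * c\<^sup>2 * L\<^sup>2)" by (simp add: mult_ac)
  finally have key: "c\<^sup>2 * (s + 1) \<le> (\<alpha> k)\<^sup>2" using cL by simp
  have "c\<^sup>2 * s \<le> c\<^sup>2 * (s + 1)" by (simp add: algebra_simps)
  then have "(c * sqrt s)\<^sup>2 \<le> (\<alpha> k)\<^sup>2" using key s by (simp add: power_mult_distrib)
  then have "c * sqrt s \<le> \<alpha> k" by (rule power2_le_imp_le) (simp add: less_imp_le)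
  then have le: "c \<le> \<alpha> (Suc k)" using s eq by (simp add: le_divide_eq)
  have "1/3 \<le> \<theta> (Suc k) \<or> 3 * c \<le> \<alpha> k"
  proof (cases "sqrt s \<le> 3")
    case True
    have "\<theta> (Suc k) = 1 / sqrt s" using eq \<alpha>_pos[of k] by (simp add: \<theta>_Suc)
    then show ?thesis using True s by (simp add: le_divide_eq divide_le_eq)
  next
    case False
    then have "3\<^sup>2 \<le> (sqrt s)\<^sup>2" by (intro power_mono) auto
    then have "c\<^sup>2 * 9 \<le> c\<^sup>2 * (s + 1)" using s by (intro mult_left_mono) auto
    then have "(3 * c)\<^sup>2 \<le> (\<alpha> k)\<^sup>2" using key by (simp add: power_mult_distrib)
    then have "3 * c \<le> \<alpha> k" by (rule power2_le_imp_le) (simp add: less_imp_le)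
    then show ?thesis by simp
  qed
  then show ?thesis using large le by simp
qed

text \<open>A short step is recovered after two growth steps, because \<open>\<theta>\<close> increases through
  \<open>sqrt (2/3)\<close> and \<open>sqrt (2/3 + 4/5)\<close> while \<open>\<alpha>\<close> loses at most the factor \<open>4/5\<close>.\<close>
lemma steps_bounded_below:
  assumes l: "\<And>k. \<bar>l k\<bar> \<le> L" and L: "L > 0"
  shows "\<exists>m>0. \<forall>k. m \<le> \<alpha> k"
proof -
  define m where "m = min (1 / (sqrt 2 * L)) (\<alpha> 0)"
  have m: "m > 0" using L by (simp add: m_def)
  \<comment> \<open>The alternatives allow for no, one or two growth steps since the last step of
    size at least \<open>m\<close>. The constants come from \<open>16/25 \<le> 2/3\<close>,
    \<open>36/25 \<le> 2/3 + 4/5\<close> and \<open>24/25 = 4/5 * 6/5\<close>; a third growth step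
    multiplies by at least 13/10 and passes \<open>m\<close> again.\<close>
  have inv: "m \<le> \<alpha> k \<or> (4/5 * m \<le> \<alpha> k \<and> 4/5 \<le> \<theta> k) \<or> (24/25 * m \<le> \<alpha> k \<and> 6/5 \<le> \<theta> k)" for k
  proof (induction k)
    case 0
    then show ?case by (simp add: m_def)
  next
    case (Suc k)
    show ?case
    proof (rule growth_or_large[OF l[of k] L refl])
      assume gr: "\<alpha> (Suc k) = sqrt (2/3 + \<theta> k) * \<alpha> k" "\<theta> (Suc k) = sqrt (2/3 + \<theta> k)"
      have mult: "r * b \<le> \<alpha> (Suc k)" if "r \<le> sqrt (2/3 + \<theta> k)" "b \<le> \<alpha> k" "r \<ge> 0" for r b
        unfolding gr(1) using that \<alpha>_pos[of k] by (smt (verit) mult_mono mult_left_mono)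
      consider "m \<le> \<alpha> k" | "4/5 * m \<le> \<alpha> k" "4/5 \<le> \<theta> k" | "24/25 * m \<le> \<alpha> k" "6/5 \<le> \<theta> k"
        using Suc.IH by blast
      then show ?case
      proof cases
        case 1
        have "4/5 \<le> sqrt (2/3 + \<theta> k)"
          by (intro real_le_rsqrt, unfold power2_eq_square) (use \<theta>_pos[of k] in linarith)
        then have "4/5 * m \<le> \<alpha> (Suc k)" "4/5 \<le> \<theta> (Suc k)"
          using mult[OF _ 1, of "4/5"] gr(2) by auto
        then show ?thesis by blast
      next
        case 2
        have "6/5 \<le> sqrt (2/3 + \<theta> k)"
          using 2 by (intro real_le_rsqrt) (simp add: power2_eq_square)
        then have "24/25 * m \<le> \<alpha> (Suc k)" "6/5 \<le> \<theta> (Suc k)"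
          using mult[OF _ 2(1), of "6/5"] gr(2) by auto
        then show ?thesis by blast
      next
        case 3
        have "13/10 \<le> sqrt (2/3 + \<theta> k)"
          using 3 by (intro real_le_rsqrt) (simp add: power2_eq_square)
        then have "156/125 * m \<le> \<alpha> (Suc k)"
          using mult[OF _ 3(1), of "13/10"] by auto
        then show ?thesis using m by linarith
      qed
    next
      assume "1 / (sqrt 2 * L) \<le> \<alpha> (Suc k)"
      then have "m \<le> \<alpha> (Suc k)" unfolding m_def by (rule min.coboundedI1)
      then show ?case by blast
    qed
  qed
  have "4/5 * m \<le> \<alpha> k" for k using inv[of k] m by linarith
  moreover have "4/5 * m > 0" using m by simp
  ultimately show ?thesis by blast
qed

text \<open>The steps below c come at most two at a time, and they are preceded by one of size at least 3c.\<close>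
lemma sum_steps_ge:
  assumes l: "\<And>k. \<bar>l k\<bar> \<le> L" and L: "L > 0" and c: "c = 1 / (sqrt 2 * L)"
    and \<alpha>0: "c \<le> \<alpha> 0" and \<theta>0: "\<theta> 0 = 1/3" and l0: "\<bar>\<alpha> 0 * l 0\<bar> \<le> 2"
  shows "real k * c \<le> (\<Sum>i=1..k. \<alpha> i)"
proof -
  have cpos: "c > 0" using L c by simp
  \<comment> \<open>The surplus over an average of \<open>c\<close> per step.\<close>
  define S where "S k = (\<Sum>i=1..k. \<alpha> i) - real k * c" for k
  have S_Suc: "S (Suc k) = S k + \<alpha> (Suc k) - c" for k
    by (simp add: S_def algebra_simps)
  \<comment> \<open>A growth step has ratio 1 because \<open>\<theta> 0 = 1/3\<close>. Otherwise
    \<open>\<alpha> 0 * l 0 \<le> 2\<close> gives \<open>s \<le> 7\<close>, so the ratio is above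
    1/3.\<close>
  have \<theta>1: "1/3 \<le> \<theta> 1"
  proof (rule step_cases[OF \<alpha>_pos, of 0])
    assume "\<alpha> (Suc 0) = sqrt (2/3 + \<theta> 0) * \<alpha> 0"
    then show ?thesis using \<theta>0 \<alpha>_pos[of 0] by (simp add: \<theta>_Suc)
  next
    define s where "s = 2 * (\<alpha> 0)\<^sup>2 * (l 0)\<^sup>2 - 1"
    assume "2 * (\<alpha> 0)\<^sup>2 * (l 0)\<^sup>2 - 1 > 0" "\<alpha> (Suc 0) = \<alpha> 0 / sqrt (2 * (\<alpha> 0)\<^sup>2 * (l 0)\<^sup>2 - 1)"
    then have s: "s > 0" and eq: "\<alpha> (Suc 0) = \<alpha> 0 / sqrt s" by (simp_all add: s_def)
    have "(\<alpha> 0 * l 0)\<^sup>2 \<le> 2\<^sup>2" using l0 by (metis abs_ge_zero power_mono power2_abs)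
    then have "s \<le> 3\<^sup>2" by (simp add: s_def power_mult_distrib)
    then have "sqrt s \<le> 3" by (rule real_le_lsqrt[rotated]) simp
    moreover have "\<theta> 1 = 1 / sqrt s" using eq \<alpha>_pos[of 0] by (simp add: \<theta>_Suc)
    ultimately show ?thesis using s by (simp add: divide_le_eq)
  qed
  have \<alpha>1: "c \<le> \<alpha> 1"
    by (rule growth_or_large[OF l[of 0] L c]) (use \<theta>0 \<alpha>0 in auto)
  \<comment> \<open>From the first state a growth step multiplies by at least
    \<open>sqrt (2/3 + 1/3) = 1\<close>. The second state follows a step of size at least
    \<open>3 * c\<close>, which saved a surplus of \<open>2 * c\<close>; growth steps into the third
    and fourth states use up at most \<open>c/5\<close> and \<open>c/25\<close> of it, and one more
    leads back to the first. \<open>S k\<close> is carried along because the saving from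
    \<open>\<alpha> (Suc k)\<close> is added to it.\<close>
  have "0 \<le> S k \<and> 0 \<le> S (Suc k) \<and>
     ((c \<le> \<alpha> (Suc k) \<and> 1/3 \<le> \<theta> (Suc k)) \<or>
      (c \<le> \<alpha> (Suc k) \<and> 2 * c \<le> S (Suc k)) \<or>
      (4/5 * c \<le> \<alpha> (Suc k) \<and> 4/5 \<le> \<theta> (Suc k) \<and> 9/5 * c \<le> S (Suc k)) \<or>
      (24/25 * c \<le> \<alpha> (Suc k) \<and> 6/5 \<le> \<theta> (Suc k) \<and> c \<le> S (Suc k)))" for k
  proof (induction k)
    case 0
    then show ?case using \<alpha>1 \<theta>1 by (simp add: S_def)
  next
    case (Suc k)
    then have S0: "0 \<le> S k" "0 \<le> S (Suc k)" by auto
    show ?case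
    proof (rule growth_or_large[OF l[of "Suc k"] L c])
      assume gr: "\<alpha> (Suc (Suc k)) = sqrt (2/3 + \<theta> (Suc k)) * \<alpha> (Suc k)"
        "\<theta> (Suc (Suc k)) = sqrt (2/3 + \<theta> (Suc k))"
      have mult: "r * b \<le> \<alpha> (Suc (Suc k))" if "r \<le> sqrt (2/3 + \<theta> (Suc k))" "b \<le> \<alpha> (Suc k)" "r \<ge> 0" for r b
        unfolding gr(1) using that \<alpha>_pos[of "Suc k"] by (smt (verit) mult_mono mult_left_mono)
      consider "c \<le> \<alpha> (Suc k)" "1/3 \<le> \<theta> (Suc k)" | "c \<le> \<alpha> (Suc k)" "2 * c \<le> S (Suc k)"
        | "4/5 * c \<le> \<alpha> (Suc k)" "4/5 \<le> \<theta> (Suc k)" "9/5 * c \<le> S (Suc k)"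
        | "24/25 * c \<le> \<alpha> (Suc k)" "6/5 \<le> \<theta> (Suc k)" "c \<le> S (Suc k)"
        using Suc.IH by blast
      then show ?case
      proof cases
        case 1
        have "1 \<le> sqrt (2/3 + \<theta> (Suc k))" using 1 by simp
        then have "c \<le> \<alpha> (Suc (Suc k))" "1 \<le> \<theta> (Suc (Suc k))"
          using mult[OF _ 1(1), of 1] gr(2) by auto
        then show ?thesis using S0 S_Suc[of "Suc k"] by linarith
      next
        case 2
        have "4/5 \<le> sqrt (2/3 + \<theta> (Suc k))"
          by (intro real_le_rsqrt, unfold power2_eq_square) (use \<theta>_pos[of "Suc k"] in linarith)
        then have "4/5 * c \<le> \<alpha> (Suc (Suc k))" "4/5 \<le> \<theta> (Suc (Suc k))"
          using mult[OF _ 2(1), of "4/5"] gr(2) by auto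
        then show ?thesis using 2 cpos S0 S_Suc[of "Suc k"] by linarith
      next
        case 3
        have "6/5 \<le> sqrt (2/3 + \<theta> (Suc k))"
          using 3 by (intro real_le_rsqrt) (simp add: power2_eq_square)
        then have "24/25 * c \<le> \<alpha> (Suc (Suc k))" "6/5 \<le> \<theta> (Suc (Suc k))"
          using mult[OF _ 3(1), of "6/5"] gr(2) by auto
        then show ?thesis using 3 cpos S0 S_Suc[of "Suc k"] by linarith
      next
        case 4
        have "13/10 \<le> sqrt (2/3 + \<theta> (Suc k))"
          using 4 by (intro real_le_rsqrt) (simp add: power2_eq_square)
        then have "156/125 * c \<le> \<alpha> (Suc (Suc k))" "13/10 \<le> \<theta> (Suc (Suc k))"
          using mult[OF _ 4(1), of "13/10"] gr(2) by auto
        then show ?thesis using 4 cpos S0 S_Suc[of "Suc k"] by linarith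
      qed
    next
      assume "c \<le> \<alpha> (Suc (Suc k))" "1/3 \<le> \<theta> (Suc (Suc k)) \<or> 3 * c \<le> \<alpha> (Suc k)"
      then show ?case using S0 S_Suc[of k] S_Suc[of "Suc k"] by linarith
    qed
  qed
  then show ?thesis by (simp add: S_def)
qed

end

section \<open>Energy inequalities for the proximal gradient iteration\<close>

text \<open>\<open>real_of_ereal\<close> sends infinity to 0, so the value is meaningful only on
  \<open>edom g\<close>; for this reason \<open>minimizes\<close> compares points of
  \<open>edom g\<close> only.\<close>

definition objective :: "('a \<Rightarrow> real) \<Rightarrow> ('a \<Rightarrow> ereal) \<Rightarrow> 'a \<Rightarrow> real"
  where "objective f g y = f y + real_of_ereal (g y)"

definition minimizes :: "('a \<Rightarrow> real) \<Rightarrow> ('a \<Rightarrow> ereal) \<Rightarrow> 'a \<Rightarrow> bool"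
  where "minimizes f g s \<longleftrightarrow> s \<in> edom g \<and> (\<forall>y\<in>edom g. objective f g s \<le> objective f g y)"

text \<open>The proximal step enters through the subgradient \<open>u (Suc k)\<close> that it
  selects, while \<open>u 0\<close> may be any subgradient at the starting point.\<close>

locale adaptive_prox = adaptive_steps \<alpha> \<theta> l
  for \<alpha> \<theta> l :: "nat \<Rightarrow> real" +
  fixes f :: "'a::euclidean_space \<Rightarrow> real" and gradf :: "'a \<Rightarrow> 'a" and g :: "'a \<Rightarrow> ereal"
    and x u :: "nat \<Rightarrow> 'a"
  assumes cvx: "convex_on UNIV f" and der: "\<And>y. GDERIV f y :> gradf y"
    and proper: "\<And>y. g y \<noteq> -\<infinity>"
    and sub: "\<And>k. u k \<in> subdiff g (x k)"
    and x_Suc: "\<And>k. x (Suc k) = x k - \<alpha> k *\<^sub>R (gradf (x k) + u (Suc k))"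
    and l_eq: "\<And>k. l k = norm (gradf (x (Suc k)) - gradf (x k)) / norm (x (Suc k) - x k)"
begin

abbreviation F :: "'a \<Rightarrow> real" where "F \<equiv> objective f g"

abbreviation minimizer :: "'a \<Rightarrow> bool" where "minimizer \<equiv> minimizes f g"

definition D :: "nat \<Rightarrow> 'a" where "D k = gradf (x k) + u k"

definition bregman :: "'a \<Rightarrow> nat \<Rightarrow> real"
  where "bregman s k = f s - f (x k) - gradf (x k) \<bullet> (s - x k)"

text \<open>The weight of the gap adds the \<open>2 * \<alpha> k\<close> of \<open>one_step\<close>
  to the \<open>3 * \<alpha> k * \<theta> k\<close> of \<open>next_gradient_bound\<close>. The
  gradient term is what the latter leaves after paying for the one on the right of
  \<open>one_step\<close>.\<close>

definition energy :: "'a \<Rightarrow> nat \<Rightarrow> real"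
  where "energy s k = (norm (x (Suc k) - s))\<^sup>2 + (\<alpha> k)\<^sup>2 * (norm (D k))\<^sup>2
    + \<alpha> k * (2 + 3 * \<theta> k) * (F (x k) - F s)"

lemma x_edom: "x k \<in> edom g"
  using sub[of k] by (simp add: subdiff_def)

lemma minimizer_le: "minimizer s \<Longrightarrow> F s \<le> F (x k)"
  using x_edom by (simp add: minimizes_def)

lemma f_tangent: "f y + gradf y \<bullet> (z - y) \<le> f z"
  by (rule convex_on_above_gradient[OF cvx der])

lemma bregman_nonneg: "bregman s k \<ge> 0"
  using f_tangent[of "x k" s] by (simp add: bregman_def)

lemma F_subgradient: "y \<in> edom g \<Longrightarrow> F (x k) + D k \<bullet> (y - x k) \<le> F y"
  using f_tangent[of "x k" y] subdiff_real_ineq[OF proper sub[of k], of y]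
  by (simp add: objective_def D_def inner_add_left)

text \<open>The subgradient inequality for \<open>u (Suc k)\<close> is tested at \<open>s\<close>,
  the one for \<open>u k\<close> at \<open>x (Suc k)\<close>. Their sum times
  \<open>2 * \<alpha> k\<close> is the claim with all squares expanded; the Bregman distance is the
  exact error of linearizing \<open>f\<close> at \<open>x k\<close>.\<close>

lemma one_step:
  assumes s: "s \<in> edom g"
  shows "(norm (x (Suc k) - s))\<^sup>2 + 2 * \<alpha> k * (F (x k) - F s) + 2 * \<alpha> k * bregman s k
      + (\<alpha> k)\<^sup>2 * (norm (u k - u (Suc k)))\<^sup>2
    \<le> (norm (x k - s))\<^sup>2 + (\<alpha> k)\<^sup>2 * (norm (D k))\<^sup>2"
proof -
  define a where "a = x k - s"
  define d where "d = gradf (x k)"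
  define v where "v = u k"
  define v' where "v' = u (Suc k)"
  define \<beta> where "\<beta> = \<alpha> k"
  define \<phi> where "\<phi> y = real_of_ereal (g y)" for y
  have "\<phi> (x (Suc k)) + v' \<bullet> (s - x (Suc k)) \<le> \<phi> s"
    using subdiff_real_ineq[OF proper sub s] by (simp add: \<phi>_def v'_def)
  moreover have "s - x (Suc k) = \<beta> *\<^sub>R (d + v') - a"
    by (simp add: x_Suc a_def d_def v'_def \<beta>_def)
  moreover have "\<phi> (x k) + v \<bullet> (x (Suc k) - x k) \<le> \<phi> (x (Suc k))"
    using subdiff_real_ineq[OF proper sub x_edom] by (simp add: \<phi>_def v_def)
  moreover have "x (Suc k) - x k = - (\<beta> *\<^sub>R (d + v'))"
    by (simp add: x_Suc d_def v'_def \<beta>_def)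
  ultimately have "\<phi> (x k) - \<phi> s - v' \<bullet> a + \<beta> * ((v' - v) \<bullet> (d + v')) \<le> 0"
    by (simp add: inner_diff_right inner_diff_left algebra_simps)
  then have "2 * \<beta> * (\<phi> (x k) - \<phi> s - v' \<bullet> a + \<beta> * ((v' - v) \<bullet> (d + v'))) \<le> 0"
    by (intro mult_nonneg_nonpos) (simp_all add: \<beta>_def less_imp_le)
  moreover have "(norm (x (Suc k) - s))\<^sup>2 + 2 * \<beta> * (F (x k) - F s) + 2 * \<beta> * bregman s k
      + \<beta>\<^sup>2 * (norm (v - v'))\<^sup>2 - (norm (x k - s))\<^sup>2 - \<beta>\<^sup>2 * (norm (D k))\<^sup>2
    = 2 * \<beta> * (\<phi> (x k) - \<phi> s - v' \<bullet> a + \<beta> * ((v' - v) \<bullet> (d + v')))"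
  proof -
    have e: "x (Suc k) - s = a - \<beta> *\<^sub>R (d + v')" "x k - s = a" "s - x k = - a" "D k = d + v"
      by (simp_all add: x_Suc a_def d_def v'_def \<beta>_def D_def v_def)
    show ?thesis
      unfolding power2_norm_eq_inner bregman_def e objective_def \<phi>_def[symmetric] d_def[symmetric]
      by (simp add: inner_diff_left inner_diff_right inner_add_left inner_add_right inner_commute
          algebra_simps power2_eq_square)
  qed
  ultimately show ?thesis by (simp add: \<beta>_def v_def v'_def)
qed

text \<open>With \<open>p\<close> the step from \<open>x (Suc k)\<close> back to \<open>x k\<close>
  divided by \<open>\<alpha> k\<close>, \<open>D (Suc k) = p + w\<close> for the change
  \<open>w\<close> of \<open>gradf\<close>. Monotonicity of \<open>gradf\<close> gives
  \<open>p \<bullet> w \<le> 0\<close>, that of the subdifferential gives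
  \<open>norm p \<le> norm (D k)\<close>, \<open>l k\<close> fixes the length of \<open>w\<close>,
  and convexity of \<open>F\<close> bounds \<open>\<alpha> k * (D (Suc k) \<bullet> p)\<close> by
  the decrease of \<open>F\<close>.\<close>

lemma next_gradient_bound:
  "2 * (\<alpha> (Suc k))\<^sup>2 * (norm (D (Suc k)))\<^sup>2
    \<le> (\<alpha> k)\<^sup>2 * (norm (D k))\<^sup>2 + 3 * \<alpha> (Suc k) * \<theta> (Suc k) * (F (x k) - F (x (Suc k)))"
proof -
  define p where "p = gradf (x k) + u (Suc k)"
  define w where "w = gradf (x (Suc k)) - gradf (x k)"
  have dx: "x k - x (Suc k) = \<alpha> k *\<^sub>R p" by (simp add: x_Suc p_def)
  then have dx': "x (Suc k) - x k = - (\<alpha> k *\<^sub>R p)" by (metis minus_diff_eq)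
  have D': "D (Suc k) = p + w" by (simp add: D_def p_def w_def)
  \<comment> \<open>If the two points agree, \<open>l k\<close> is 0 / 0 = 0 and \<open>w\<close>
    vanishes as well.\<close>
  have "l k * norm (x (Suc k) - x k) = norm w"
    unfolding l_eq w_def by (cases "x (Suc k) = x k") auto
  then have "norm w = l k * (\<alpha> k * norm p)" by (simp add: dx' less_imp_le)
  then have w2: "w \<bullet> w = (l k)\<^sup>2 * (\<alpha> k)\<^sup>2 * (p \<bullet> p)"
    by (simp add: power_mult_distrib flip: power2_norm_eq_inner)
  have "gradf (x k) \<bullet> (x (Suc k) - x k) + gradf (x (Suc k)) \<bullet> (x k - x (Suc k)) \<le> 0"
    using f_tangent[of "x k" "x (Suc k)"] f_tangent[of "x (Suc k)" "x k"] by linarith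
  then have "\<alpha> k * (p \<bullet> w) \<le> 0"
    by (simp add: dx dx' w_def inner_diff_right inner_commute algebra_simps)
  then have pw: "p \<bullet> w \<le> 0"
    using mult_le_cancel_left_pos[OF \<alpha>_pos[of k], of "p \<bullet> w" 0] by simp
  have "u k \<bullet> (x (Suc k) - x k) + u (Suc k) \<bullet> (x k - x (Suc k)) \<le> 0"
    using subdiff_real_ineq[OF proper sub[of k] x_edom[of "Suc k"]]
      subdiff_real_ineq[OF proper sub[of "Suc k"] x_edom[of k]] by linarith
  then have "\<alpha> k * (p \<bullet> (u (Suc k) - u k)) \<le> 0"
    by (simp add: dx dx' inner_diff_right inner_commute algebra_simps)
  then have "p \<bullet> (u (Suc k) - u k) \<le> 0"
    using mult_le_cancel_left_pos[OF \<alpha>_pos[of k], of "p \<bullet> (u (Suc k) - u k)" 0] by simp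
  moreover have "D k = p - (u (Suc k) - u k)" by (simp add: D_def p_def)
  ultimately have pD: "p \<bullet> p \<le> (norm (D k))\<^sup>2"
    unfolding power2_norm_eq_inner using inner_ge_zero[of "u (Suc k) - u k"]
    by (simp add: inner_diff_left inner_diff_right inner_commute)
  have "\<alpha> k * (D (Suc k) \<bullet> p) \<le> F (x k) - F (x (Suc k))"
    using F_subgradient[OF x_edom[of k], of "Suc k"] by (simp add: dx)
  then have "3 * \<alpha> (Suc k) * \<theta> (Suc k) * (\<alpha> k * (D (Suc k) \<bullet> p))
      \<le> 3 * \<alpha> (Suc k) * \<theta> (Suc k) * (F (x k) - F (x (Suc k)))"
    by (intro mult_left_mono) (simp_all add: less_imp_le)
  moreover have "3 * \<alpha> (Suc k) * \<theta> (Suc k) * (\<alpha> k * (D (Suc k) \<bullet> p)) = 3 * (\<alpha> (Suc k))\<^sup>2 * (D (Suc k) \<bullet> p)"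
    using \<alpha>_pos[of k] by (simp add: \<theta>_Suc power2_eq_square)
  ultimately have Fdec: "3 * (\<alpha> (Suc k))\<^sup>2 * (D (Suc k) \<bullet> p)
      \<le> 3 * \<alpha> (Suc k) * \<theta> (Suc k) * (F (x k) - F (x (Suc k)))" by linarith
  \<comment> \<open>The split isolates the bracket of the step size rule as coefficient of
    \<open>p \<bullet> p\<close>; three copies of \<open>D (Suc k) \<bullet> p\<close> go into the
    decrease of \<open>F\<close>, and \<open>p \<bullet> w\<close> has the right sign to be
    dropped.\<close>
  have "2 * (norm (D (Suc k)))\<^sup>2 = (2 * (\<alpha> k)\<^sup>2 * (l k)\<^sup>2 - 1) * (p \<bullet> p) + 3 * (D (Suc k) \<bullet> p) + p \<bullet> w"
    unfolding power2_norm_eq_inner D'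
    by (simp add: inner_add_left inner_add_right inner_commute w2 algebra_simps)
  also have "\<dots> \<le> (2 * (\<alpha> k)\<^sup>2 * (l k)\<^sup>2 - 1) * (p \<bullet> p) + 3 * (D (Suc k) \<bullet> p)" using pw by simp
  finally have "(\<alpha> (Suc k))\<^sup>2 * (2 * (norm (D (Suc k)))\<^sup>2)
      \<le> (\<alpha> (Suc k))\<^sup>2 * ((2 * (\<alpha> k)\<^sup>2 * (l k)\<^sup>2 - 1) * (p \<bullet> p) + 3 * (D (Suc k) \<bullet> p))"
    by (intro mult_left_mono) auto
  also have "\<dots> = (\<alpha> (Suc k))\<^sup>2 * (2 * (\<alpha> k)\<^sup>2 * (l k)\<^sup>2 - 1) * (p \<bullet> p) + 3 * (\<alpha> (Suc k))\<^sup>2 * (D (Suc k) \<bullet> p)"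
    by (simp add: algebra_simps)
  also have "\<dots> \<le> (\<alpha> k)\<^sup>2 * (p \<bullet> p) + 3 * \<alpha> (Suc k) * \<theta> (Suc k) * (F (x k) - F (x (Suc k)))"
    using curvature_bound[of k] Fdec by (intro add_mono mult_right_mono) auto
  also have "\<dots> \<le> (\<alpha> k)\<^sup>2 * (norm (D k))\<^sup>2 + 3 * \<alpha> (Suc k) * \<theta> (Suc k) * (F (x k) - F (x (Suc k)))"
    using pD by (intro add_mono mult_left_mono) auto
  finally show ?thesis by (simp add: mult_ac)
qed

text \<open>Add \<open>one_step\<close> at \<open>Suc k\<close> and
  \<open>next_gradient_bound\<close> at \<open>k\<close>. The gap term stays explicit because the
  rate comes from summing it; \<open>energy_decrease\<close> drops it for the convergence
  proof.\<close>

lemma energy_step: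
  assumes s: "s \<in> edom g"
  shows "energy s (Suc k) + 2 * \<alpha> (Suc k) * bregman s (Suc k)
      + (\<alpha> (Suc k))\<^sup>2 * (norm (u (Suc k) - u (Suc (Suc k))))\<^sup>2
      + (\<alpha> k * (2 + 3 * \<theta> k) - 3 * \<alpha> (Suc k) * \<theta> (Suc k)) * (F (x k) - F s) \<le> energy s k"
  using one_step[OF s, of "Suc k"] next_gradient_bound[of k]
  unfolding energy_def by (simp add: algebra_simps)

lemma energy_decrease:
  assumes "minimizer s"
  shows "energy s (Suc k) + 2 * \<alpha> (Suc k) * bregman s (Suc k)
      + (\<alpha> (Suc k))\<^sup>2 * (norm (u (Suc k) - u (Suc (Suc k))))\<^sup>2 \<le> energy s k"
proof -
  have "0 \<le> (\<alpha> k * (2 + 3 * \<theta> k) - 3 * \<alpha> (Suc k) * \<theta> (Suc k)) * (F (x k) - F s)"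
    using growth_bound[of k] minimizer_le[OF assms, of k] by simp
  moreover have "s \<in> edom g" using assms by (simp add: minimizes_def)
  ultimately show ?thesis using energy_step[of s k] by linarith
qed

lemma energy_antimono:
  assumes "minimizer s"
  shows "decseq (energy s)"
proof (rule decseq_SucI)
  fix k
  have "0 \<le> 2 * \<alpha> (Suc k) * bregman s (Suc k)" using bregman_nonneg by (simp add: less_imp_le)
  moreover have "0 \<le> (\<alpha> (Suc k))\<^sup>2 * (norm (u (Suc k) - u (Suc (Suc k))))\<^sup>2" by simp
  ultimately show "energy s (Suc k) \<le> energy s k" using energy_decrease[OF assms, of k] by linarith
qed

lemma norm_le_energy:
  assumes "minimizer s"
  shows "(norm (x (Suc k) - s))\<^sup>2 \<le> energy s k"
proof -
  have "0 \<le> \<alpha> k * (2 + 3 * \<theta> k) * (F (x k) - F s)"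
    using minimizer_le[OF assms, of k] by (intro mult_nonneg_nonneg) (auto simp: less_imp_le add_nonneg_nonneg)
  then show ?thesis unfolding energy_def by (simp add: add_nonneg_nonneg)
qed

definition radius2 :: "'a \<Rightarrow> real"
  where "radius2 s = (norm (x 0 - s))\<^sup>2 + 2 * (\<alpha> 0)\<^sup>2 * (norm (D 0))\<^sup>2
    + 3 * \<theta> 0 * \<alpha> 0 * (F (x 0) - F s)"

text \<open>Applying \<open>one_step\<close> at 0 trades the distance of \<open>x 1\<close> for that
  of \<open>x 0\<close>: it absorbs \<open>2 * \<alpha> 0\<close> times the gap and doubles the
  gradient term. For \<open>\<theta> 0 = 1/3\<close> the bound is the squared radius of the
  theorem.\<close>

lemma energy_0_le:
  assumes "minimizer s"
  shows "energy s 0 \<le> radius2 s"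
proof -
  have "s \<in> edom g" using assms by (simp add: minimizes_def)
  moreover have "0 \<le> 2 * \<alpha> 0 * bregman s 0" using bregman_nonneg by (simp add: less_imp_le)
  moreover have "0 \<le> (\<alpha> 0)\<^sup>2 * (norm (u 0 - u (Suc 0)))\<^sup>2" by simp
  ultimately have "(norm (x (Suc 0) - s))\<^sup>2 + 2 * \<alpha> 0 * (F (x 0) - F s)
      \<le> (norm (x 0 - s))\<^sup>2 + (\<alpha> 0)\<^sup>2 * (norm (D 0))\<^sup>2"
    using one_step[of s 0] by linarith
  then show ?thesis
    unfolding energy_def radius2_def by (simp add: algebra_simps)
qed

text \<open>This keeps the whole trajectory, \<open>x 0\<close> included, in one ball, so a
  Lipschitz constant of \<open>gradf\<close> there bounds every \<open>l k\<close>.\<close>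

lemma dist_le_radius2:
  assumes "minimizer s"
  shows "(norm (x k - s))\<^sup>2 \<le> radius2 s"
proof (cases k)
  case 0
  have "0 \<le> 3 * \<theta> 0 * \<alpha> 0 * (F (x 0) - F s)"
    using minimizer_le[OF assms, of 0] by (simp add: less_imp_le)
  then show ?thesis unfolding radius2_def 0 by (simp add: add_nonneg_nonneg)
next
  case (Suc j)
  have "energy s j \<le> energy s 0" using energy_antimono[OF assms] by (simp add: decseq_def)
  then show ?thesis using norm_le_energy[OF assms, of j] energy_0_le[OF assms] Suc by simp
qed

text \<open>Sum \<open>energy_step\<close> with each gap replaced by its lower bound
  \<open>m\<close>: the weights telescope to twice the sum of the steps, up to boundary terms of the
  right sign.\<close>

lemma weighted_gap_bound:
  assumes s: "minimizer s" and k: "k \<ge> 1" and m: "m \<ge> 0"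
    and le: "\<And>i. 1 \<le> i \<Longrightarrow> i \<le> k \<Longrightarrow> m \<le> F (x i) - F s"
  shows "2 * m * (\<Sum>i=1..k. \<alpha> i) \<le> radius2 s"
proof -
  have dom: "s \<in> edom g" using s by (simp add: minimizes_def)
  \<comment> \<open>The subtracted term is the part of the telescoping sum still open at
    \<open>j\<close>; the gap inside \<open>energy s k\<close> closes it at the end. The gap at
    \<open>x 0\<close>, which \<open>m\<close> does not bound, is dropped in the base case.\<close>
  have "energy s (Suc j) - 3 * \<alpha> (Suc j) * \<theta> (Suc j) * m + 2 * m * (\<Sum>i=1..j. \<alpha> i) \<le> energy s 0"
    if "Suc j \<le> k" for j
    using that
  proof (induction j)
    case 0
    have "0 \<le> 3 * \<alpha> (Suc 0) * \<theta> (Suc 0) * m" using m by (simp add: less_imp_le)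
    moreover have "energy s (Suc 0) \<le> energy s 0" using energy_antimono[OF s] by (simp add: decseq_def)
    ultimately show ?case by (simp add: mult_ac)
  next
    case (Suc j)
    let ?w = "\<alpha> (Suc j) * (2 + 3 * \<theta> (Suc j)) - 3 * \<alpha> (Suc (Suc j)) * \<theta> (Suc (Suc j))"
    have "?w * m \<le> ?w * (F (x (Suc j)) - F s)"
      using growth_bound[of "Suc j"] le[of "Suc j"] Suc.prems by (intro mult_left_mono) auto
    moreover have "0 \<le> 2 * \<alpha> (Suc (Suc j)) * bregman s (Suc (Suc j))"
      using bregman_nonneg by (simp add: less_imp_le)
    moreover have "0 \<le> (\<alpha> (Suc (Suc j)))\<^sup>2 * (norm (u (Suc (Suc j)) - u (Suc (Suc (Suc j)))))\<^sup>2" by simp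
    ultimately have "energy s (Suc (Suc j)) + ?w * m \<le> energy s (Suc j)"
      using energy_step[OF dom, of "Suc j"] by linarith
    then show ?case using Suc by (simp add: algebra_simps)
  qed
  moreover obtain j where j: "k = Suc j" using k by (cases k) auto
  ultimately have "energy s k - 3 * \<alpha> k * \<theta> k * m + 2 * m * (\<Sum>i=1..j. \<alpha> i) \<le> energy s 0" by simp
  moreover have "\<alpha> k * (2 + 3 * \<theta> k) * m \<le> energy s k"
  proof -
    have "\<alpha> k * (2 + 3 * \<theta> k) * m \<le> \<alpha> k * (2 + 3 * \<theta> k) * (F (x k) - F s)"
      using le[of k] k by (intro mult_left_mono) (auto simp: less_imp_le add_nonneg_nonneg)
    then show ?thesis unfolding energy_def by (simp add: add_nonneg_nonneg add_increasing)
  qed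
  moreover have "2 * m * (\<Sum>i=1..k. \<alpha> i) = 2 * m * (\<Sum>i=1..j. \<alpha> i) + 2 * m * \<alpha> k"
    by (simp add: j algebra_simps)
  ultimately show ?thesis using energy_0_le[OF s] by (simp add: algebra_simps)
qed

lemma l_nonneg: "0 \<le> l k"
  by (simp add: l_eq)

lemma l_le:
  assumes "L-lipschitz_on S gradf" "x k \<in> S" "x (Suc k) \<in> S"
  shows "l k \<le> L"
proof (cases "x (Suc k) = x k")
  case True
  then show ?thesis using lipschitz_on_nonneg[OF assms(1)] by (simp add: l_eq)
next
  case False
  then show ?thesis using lipschitz_onD[OF assms(1,3,2)]
    by (simp add: l_eq divide_le_eq dist_norm)
qed

section \<open>Convergence of the iterates\<close>

lemma energy_tendsto:
  assumes "minimizer s"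
  obtains e where "energy s \<longlonglongrightarrow> e"
proof -
  have "0 \<le> energy s k" for k
    using norm_le_energy[OF assms, of k] order_trans zero_le_power2 by blast
  then show ?thesis using decseq_convergent[OF energy_antimono[OF assms]] that by blast
qed

lemma converges:
  assumes lsc: "lower_semicontinuous g" and lip: "locally_Lipschitz gradf" and s: "minimizer s"
  shows "\<exists>z. minimizer z \<and> x \<longlonglongrightarrow> z"
proof -
  define r where "r = sqrt (radius2 s)"
  have dist: "norm (x k - s) \<le> r" for k
    unfolding r_def by (rule real_le_rsqrt[OF dist_le_radius2[OF s]])
  have in_ball: "x k \<in> cball s r" for k using dist by (simp add: dist_norm norm_minus_commute)
  then have bdd: "bounded (range x)" using bounded_subset[OF bounded_cball] by blast
  obtain L where L: "L-lipschitz_on (cball s r) gradf"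
    using lip unfolding locally_Lipschitz_def by (meson compact_cball)
  \<comment> \<open>\<open>L\<close> may be 0, whereas \<open>steps_bounded_below\<close> takes a
    positive bound.\<close>
  have l_bound: "\<bar>l k\<bar> \<le> max L 1" for k
    using l_le[OF L in_ball in_ball, of k] l_nonneg[of k] by simp
  have "max L 1 > 0" by simp
  then obtain m where m: "m > 0" "\<And>k. m \<le> \<alpha> k"
    using steps_bounded_below[OF l_bound] by blast

  have f_cont: "isCont f z" for z
    using der[of z] by (simp add: gderiv_def has_derivative_continuous)
  have grad_cont: "isCont gradf z" for z
  proof -
    obtain K where "K-lipschitz_on (cball z 1) gradf"
      using lip unfolding locally_Lipschitz_def by (meson compact_cball)
    then have "continuous_on (cball z 1) gradf" by (rule lipschitz_on_continuous_on)
    then show ?thesis by (rule continuous_on_interior) simp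
  qed

  obtain e where "energy s \<longlonglongrightarrow> e" using energy_tendsto[OF s] .
  then have "(\<lambda>k. energy s k - energy s (Suc k)) \<longlonglongrightarrow> e - e"
    by (intro tendsto_diff LIMSEQ_Suc)
  then have dec: "(\<lambda>k. energy s k - energy s (Suc k)) \<longlonglongrightarrow> 0" by simp

  \<comment> \<open>Energy decrements tend to 0 and, since \<open>m \<le> \<alpha> k\<close>,
    dominate both nonnegative terms of \<open>energy_decrease\<close> up to constants.\<close>
  have "(\<lambda>k. bregman s (Suc k)) \<longlonglongrightarrow> 0"
  proof (rule tendsto_sandwich[OF _ _ tendsto_const])
    show "\<forall>\<^sub>F k in sequentially. 0 \<le> bregman s (Suc k)" using bregman_nonneg by simp
    show "\<forall>\<^sub>F k in sequentially. bregman s (Suc k) \<le> (energy s k - energy s (Suc k)) / (2 * m)"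
    proof (rule always_eventually, rule allI)
      fix k
      have "2 * m * bregman s (Suc k) \<le> 2 * \<alpha> (Suc k) * bregman s (Suc k)"
        using m bregman_nonneg by (intro mult_right_mono) auto
      moreover have "0 \<le> (\<alpha> (Suc k))\<^sup>2 * (norm (u (Suc k) - u (Suc (Suc k))))\<^sup>2" by simp
      ultimately have "2 * m * bregman s (Suc k) \<le> energy s k - energy s (Suc k)"
        using energy_decrease[OF s, of k] by linarith
      then show "bregman s (Suc k) \<le> (energy s k - energy s (Suc k)) / (2 * m)"
        using m(1) by (simp add: le_divide_eq mult_ac)
    qed
    show "(\<lambda>k. (energy s k - energy s (Suc k)) / (2 * m)) \<longlonglongrightarrow> 0"
      using tendsto_divide_zero[OF dec] .
  qed
  then have breg: "bregman s \<longlonglongrightarrow> 0" by (simp add: filterlim_sequentially_Suc)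

  have "(\<lambda>k. (norm (u (Suc k) - u (Suc (Suc k))))\<^sup>2) \<longlonglongrightarrow> 0"
  proof (rule tendsto_sandwich[OF _ _ tendsto_const])
    show "\<forall>\<^sub>F k in sequentially. (norm (u (Suc k) - u (Suc (Suc k))))\<^sup>2
        \<le> (energy s k - energy s (Suc k)) / m\<^sup>2"
    proof (rule always_eventually, rule allI)
      fix k
      have "m\<^sup>2 * (norm (u (Suc k) - u (Suc (Suc k))))\<^sup>2
          \<le> (\<alpha> (Suc k))\<^sup>2 * (norm (u (Suc k) - u (Suc (Suc k))))\<^sup>2"
        using m by (intro mult_right_mono power_mono) auto
      moreover have "0 \<le> 2 * \<alpha> (Suc k) * bregman s (Suc k)" using bregman_nonneg by simp
      ultimately have "m\<^sup>2 * (norm (u (Suc k) - u (Suc (Suc k))))\<^sup>2 \<le> energy s k - energy s (Suc k)"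
        using energy_decrease[OF s, of k] by linarith
      then show "(norm (u (Suc k) - u (Suc (Suc k))))\<^sup>2 \<le> (energy s k - energy s (Suc k)) / m\<^sup>2"
        using m(1) by (simp add: le_divide_eq mult_ac)
    qed
    show "(\<lambda>k. (energy s k - energy s (Suc k)) / m\<^sup>2) \<longlonglongrightarrow> 0"
      using tendsto_divide_zero[OF dec] .
  qed simp
  then have "(\<lambda>k. sqrt ((norm (u (Suc k) - u (Suc (Suc k))))\<^sup>2)) \<longlonglongrightarrow> sqrt 0"
    by (rule tendsto_real_sqrt)
  then have u_diff: "(\<lambda>k. u (Suc k) - u (Suc (Suc k))) \<longlonglongrightarrow> 0" by (simp add: tendsto_norm_zero_iff)

  \<comment> \<open>At any cluster point \<open>z\<close> the Bregman distance to \<open>s\<close>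
    vanishes, so \<open>gradf z = gradf s\<close>: the limit does not depend on the
    subsequence.\<close>
  have grad: "(\<lambda>k. gradf (x k)) \<longlonglongrightarrow> gradf s"
  proof (rule bounded_cluster_limit[OF bdd])
    fix \<rho> :: "nat \<Rightarrow> nat" and z assume \<rho>: "strict_mono \<rho>" and z: "(x \<circ> \<rho>) \<longlonglongrightarrow> z"
    have fz: "(\<lambda>n. f (x (\<rho> n))) \<longlonglongrightarrow> f z" and gz: "(\<lambda>n. gradf (x (\<rho> n))) \<longlonglongrightarrow> gradf z"
      and xz: "(\<lambda>n. x (\<rho> n)) \<longlonglongrightarrow> z"
      using isCont_tendsto_compose[OF f_cont z] isCont_tendsto_compose[OF grad_cont z] z
      by (simp_all add: o_def)
    have "(\<lambda>n. bregman s (\<rho> n)) \<longlonglongrightarrow> f s - f z - gradf z \<bullet> (s - z)"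
      unfolding bregman_def by (intro tendsto_intros fz gz xz)
    moreover have "(\<lambda>n. bregman s (\<rho> n)) \<longlonglongrightarrow> 0"
      using LIMSEQ_subseq_LIMSEQ[OF breg \<rho>] by (simp add: o_def)
    ultimately have "f s - f z - gradf z \<bullet> (s - z) = 0" by (rule LIMSEQ_unique)
    then have "gradf s = gradf z" by (intro convex_tangent_gradient_eq[OF cvx der]) simp
    then show "((\<lambda>k. gradf (x k)) \<circ> \<rho>) \<longlonglongrightarrow> gradf s" using gz by (simp add: o_def)
  qed
  have "(\<lambda>k. gradf (x (Suc k)) - gradf (x k)) \<longlonglongrightarrow> gradf s - gradf s"
    by (intro tendsto_diff grad LIMSEQ_Suc[OF grad])
  then have grad_diff: "(\<lambda>k. gradf (x (Suc k)) - gradf (x k)) \<longlonglongrightarrow> 0" by simp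

  \<comment> \<open>This is \<open>x k - x (Suc k)\<close> divided by \<open>\<alpha> k\<close>; its
    increment combines the two null sequences \<open>grad_diff\<close> and
    \<open>u_diff\<close>.\<close>
  define p where "p k = gradf (x k) + u (Suc k)" for k
  have "(\<lambda>k. (gradf (x (Suc k)) - gradf (x k)) - (u (Suc k) - u (Suc (Suc k)))) \<longlonglongrightarrow> 0 - 0"
    by (intro tendsto_diff grad_diff u_diff)
  then have "(\<lambda>k. p (Suc k) - p k) \<longlonglongrightarrow> 0"
    by (simp add: p_def algebra_simps)
  then have "p \<longlonglongrightarrow> 0"
    using slowly_varying_increment_tendsto_0[of x s r \<alpha> p m, OF dist _ m(2,1)] x_Suc
    by (simp add: p_def)
  then have "(\<lambda>k. p k + (gradf (x (Suc k)) - gradf (x k))) \<longlonglongrightarrow> 0 + 0"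
    by (intro tendsto_add grad_diff)
  then have "(\<lambda>k. D (Suc k)) \<longlonglongrightarrow> 0" by (simp add: p_def D_def algebra_simps)
  then have D0: "D \<longlonglongrightarrow> 0" by (simp add: filterlim_sequentially_Suc)

  have "(\<lambda>k. F (x k) - F s) \<longlonglongrightarrow> 0"
  proof (rule tendsto_sandwich[OF _ _ tendsto_const])
    show "\<forall>\<^sub>F k in sequentially. 0 \<le> F (x k) - F s" using minimizer_le[OF s] by simp
    show "\<forall>\<^sub>F k in sequentially. F (x k) - F s \<le> norm (D k) * r"
    proof (rule always_eventually, rule allI)
      fix k
      have "F (x k) - F s \<le> D k \<bullet> (x k - s)"
        using F_subgradient[of s k] s by (simp add: minimizes_def inner_diff_right)
      also have "\<dots> \<le> norm (D k) * norm (x k - s)" by (rule norm_cauchy_schwarz)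
      also have "\<dots> \<le> norm (D k) * r" using dist by (intro mult_left_mono) auto
      finally show "F (x k) - F s \<le> norm (D k) * r" .
    qed
    show "(\<lambda>k. norm (D k) * r) \<longlonglongrightarrow> 0"
      by (rule tendsto_mult_left_zero[OF tendsto_norm_zero[OF D0]])
  qed
  then have F_lim: "(\<lambda>k. F (x k)) \<longlonglongrightarrow> F s" by (simp add: LIM_zero_iff)

  \<comment> \<open>\<open>F (x k) - f (x k)\<close> is \<open>g (x k)\<close> and converges along
    the subsequence, so lower semicontinuity bounds \<open>g z\<close>.\<close>
  have cluster: "minimizer z" if \<rho>: "strict_mono \<rho>" and z: "(x \<circ> \<rho>) \<longlonglongrightarrow> z" for \<rho> z
  proof -
    have "(\<lambda>n. F (x (\<rho> n)) - f (x (\<rho> n))) \<longlonglongrightarrow> F s - f z"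
      using LIMSEQ_subseq_LIMSEQ[OF F_lim \<rho>] isCont_tendsto_compose[OF f_cont z]
      by (intro tendsto_diff) (simp_all add: o_def)
    moreover have "g ((x \<circ> \<rho>) n) \<le> ereal (F (x (\<rho> n)) - f (x (\<rho> n)))" for n
      using x_edom[of "\<rho> n"] proper[of "x (\<rho> n)"]
      by (cases "g (x (\<rho> n))") (auto simp: objective_def edom_def)
    ultimately have "g z \<le> ereal (F s - f z)"
      using lower_semicontinuous_limit_le[OF lsc z] by blast
    then have "z \<in> edom g" "F z \<le> F s"
      using proper[of z] by (cases "g z"; auto simp: edom_def objective_def)+
    then show ?thesis using s by (auto simp: minimizes_def intro: order_trans)
  qed

  obtain z \<rho> where \<rho>: "strict_mono (\<rho>::nat\<Rightarrow>nat)" "(x \<circ> \<rho>) \<longlonglongrightarrow> z"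
    using bounded_imp_convergent_subsequence[OF bdd] by blast
  have "x \<longlonglongrightarrow> z"
  proof (rule bounded_cluster_limit[OF bdd])
    fix \<sigma> :: "nat \<Rightarrow> nat" and y assume \<sigma>: "strict_mono \<sigma>" and y: "(x \<circ> \<sigma>) \<longlonglongrightarrow> y"
    have mins: "minimizer z" "minimizer y" using cluster \<rho> \<sigma> y by auto
    then have Feq: "F z = F y" by (auto simp: minimizes_def intro: order_antisym)
    \<comment> \<open>The energies for \<open>z\<close> and \<open>y\<close> differ in the distance
      terms only, so \<open>h\<close> converges. Along the subsequences tending to \<open>z\<close>
      and to \<open>y\<close> its limits are minus and plus the square of
      \<open>norm (y - z)\<close>.\<close>
    define h where "h k = (norm (x k - z))\<^sup>2 - (norm (x k - y))\<^sup>2" for k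
    obtain a b where "energy z \<longlonglongrightarrow> a" "energy y \<longlonglongrightarrow> b"
      using energy_tendsto[OF mins(1)] energy_tendsto[OF mins(2)] by metis
    then have "(\<lambda>k. energy z k - energy y k) \<longlonglongrightarrow> a - b" by (intro tendsto_diff)
    then have "(\<lambda>k. h (Suc k)) \<longlonglongrightarrow> a - b" by (simp add: energy_def h_def Feq)
    then have h: "h \<longlonglongrightarrow> a - b" by (simp add: filterlim_sequentially_Suc)
    have lim: "(h \<circ> \<tau>) \<longlonglongrightarrow> (norm (w - z))\<^sup>2 - (norm (w - y))\<^sup>2"
      if "(x \<circ> \<tau>) \<longlonglongrightarrow> w" for \<tau> w
      using that unfolding h_def o_def by (intro tendsto_intros)
    have "(norm (z - z))\<^sup>2 - (norm (z - y))\<^sup>2 = a - b"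
      using LIMSEQ_unique[OF lim[OF \<rho>(2)] LIMSEQ_subseq_LIMSEQ[OF h \<rho>(1)]] .
    moreover have "(norm (y - z))\<^sup>2 - (norm (y - y))\<^sup>2 = a - b"
      using LIMSEQ_unique[OF lim[OF y] LIMSEQ_subseq_LIMSEQ[OF h \<sigma>]] .
    ultimately have "(norm (y - z))\<^sup>2 = 0"
      using norm_minus_commute[of y z] zero_le_power2[of "norm (y - z)"] by simp
    then show "(x \<circ> \<sigma>) \<longlonglongrightarrow> z" using y by simp
  qed
  then show ?thesis using cluster \<rho> by blast
qed

end

section \<open>Extended-valued minimizers and the final estimates\<close>

lemma is_arg_min_minimizes:
  assumes proper: "\<And>y. g y \<noteq> -\<infinity>" and dom: "x0 \<in> edom g"
    and min: "is_arg_min (\<lambda>y. ereal (f y) + g y) (\<lambda>_. True) s"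
  shows "minimizes f g s"
proof -
  have le: "ereal (f s) + g s \<le> ereal (f y) + g y" for y
    using min by (auto simp: is_arg_min_def not_less)
  have "s \<in> edom g" using le[of x0] dom by (auto simp: edom_def)
  then show ?thesis unfolding minimizes_def
  proof safe
    fix y assume "s \<in> edom g" "y \<in> edom g"
    then show "objective f g s \<le> objective f g y"
      using le[of y] proper[of s] proper[of y]
      by (cases "g s"; cases "g y") (auto simp: objective_def edom_def)
  qed
qed

lemma minimizes_is_arg_min:
  assumes proper: "\<And>y. g y \<noteq> -\<infinity>" and min: "minimizes f g s"
  shows "is_arg_min (\<lambda>y. ereal (f y) + g y) (\<lambda>_. True) s"
proof -
  have "ereal (f s) + g s \<le> ereal (f y) + g y" for y
  proof -
    have "s \<in> edom g" "y \<in> edom g \<longrightarrow> objective f g s \<le> objective f g y"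
      using min by (auto simp: minimizes_def)
    then show ?thesis
      using proper[of s] proper[of y]
      by (cases "g s"; cases "g y") (auto simp: objective_def edom_def)
  qed
  then show ?thesis by (simp add: is_arg_min_def not_less)
qed

lemma adaptive_prox_grad_steps:
  assumes "adaptive_prox_grad gradf g x \<alpha> \<theta>"
  shows "adaptive_steps \<alpha> \<theta> (\<lambda>k. lip_est gradf x (Suc k))"
proof
  show "\<alpha> 0 > 0" "\<theta> 0 > 0" using assms by (simp_all add: adaptive_prox_grad_def)
  fix k
  have "Suc k \<ge> 1" by simp
  then show "\<theta> (Suc k) = \<alpha> (Suc k) / \<alpha> k"
    "ereal (\<alpha> (Suc k)) = min (ereal (sqrt (2/3 + \<theta> k) * \<alpha> k))
      (ereal (\<alpha> k) / ereal (sqrt (max (2 * (\<alpha> k)\<^sup>2 * (lip_est gradf x (Suc k))\<^sup>2 - 1) 0)))"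
    using assms unfolding adaptive_prox_grad_def by (metis diff_Suc_1)+
qed

theorem theorem3:
  fixes f :: "real ^ 'd \<Rightarrow> real"
    and gradf :: "real ^ 'd \<Rightarrow> real ^ 'd"
    and g F :: "real ^ 'd \<Rightarrow> ereal"
    and Fstar :: ereal
    and x :: "nat \<Rightarrow> real ^ 'd"
    and \<alpha> \<theta> :: "nat \<Rightarrow> real"
  assumes "convex_on UNIV f"
    and "\<And>y. GDERIV f y :> gradf y"
    and "locally_Lipschitz gradf"
    and "\<And>y. g y \<noteq> -\<infinity>"
    and "econvex g"
    and "lower_semicontinuous g"
    and "F = (\<lambda>y. ereal (f y) + g y)"
    and "\<exists>xs. is_arg_min F (\<lambda>_. True) xs"
    and "Fstar = (INF y. F y)"
    and "adaptive_prox_grad gradf g x \<alpha> \<theta>"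
  shows "(\<exists>xs. is_arg_min F (\<lambda>_. True) xs \<and> x \<longlonglongrightarrow> xs) \<and>
    (\<forall>xs v R.
       is_arg_min F (\<lambda>_. True) xs \<and> v \<in> subdiff g (x 0) \<and>
       R = sqrt ((norm (x 0 - xs))\<^sup>2 + 2 * (\<alpha> 0)\<^sup>2 * (norm (gradf (x 0) + v))\<^sup>2
                 + \<alpha> 0 * real_of_ereal (F (x 0) - Fstar)) \<longrightarrow>
       (\<forall>k\<ge>1. Min ((\<lambda>i. F (x i) - Fstar) ` {1..k}) \<le> ereal (R\<^sup>2 / (2 * (\<Sum>i=1..k. \<alpha> i)))) \<and>
       (\<alpha> 0 * lip_est gradf x 1 \<in> {1 / sqrt 2..2} \<longrightarrow>
          (\<forall>L. L-lipschitz_on (cball xs R) gradf \<longrightarrow>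
             (\<forall>k\<ge>1. Min ((\<lambda>i. F (x i) - Fstar) ` {1..k}) \<le> ereal (L * R\<^sup>2 / (sqrt 2 * real k))))))"
proof -
  note cvx = assms(1) and der = assms(2) and lip = assms(3) and proper = assms(4)
    and gcvx = assms(5) and lsc = assms(6) and F = assms(7) and alg = assms(10)
  define l where "l k = lip_est gradf x (Suc k)" for k
  interpret steps: adaptive_steps \<alpha> \<theta> l
    unfolding l_def by (rule adaptive_prox_grad_steps[OF alg])
  have dom0: "x 0 \<in> edom g" and \<theta>0: "\<theta> 0 = 1/3" using alg by (auto simp: adaptive_prox_grad_def)
  obtain xs0 where xs0: "is_arg_min F (\<lambda>_. True) xs0" using assms(8) by blast
  have min_xs0: "minimizes f g xs0"
    using is_arg_min_minimizes[OF proper dom0] xs0 unfolding F by blast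
  \<comment> \<open>Fermat's rule at a solution supplies the subgradient from which
    \<open>prox_subdiff\<close> derives that all proximal steps are well defined.\<close>
  have sub0: "- gradf xs0 \<in> subdiff g xs0"
  proof (rule minimizer_subdiff[OF proper gcvx der])
    show "xs0 \<in> edom g" using min_xs0 by (simp add: minimizes_def)
    show "ereal (f xs0) + g xs0 \<le> ereal (f y) + g y" for y
      using xs0 unfolding F by (auto simp: is_arg_min_def not_less)
  qed
  have x_prox: "x (Suc k) = prox (\<alpha> k) g (x k - \<alpha> k *\<^sub>R gradf (x k))" for k
    using alg unfolding adaptive_prox_grad_def by (cases k) auto
  define w where "w k = (x k - \<alpha> k *\<^sub>R gradf (x k) - x (Suc k)) /\<^sub>R \<alpha> k" for k
  have w_sub: "w k \<in> subdiff g (x (Suc k))" for k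
    unfolding w_def x_prox by (rule prox_subdiff[OF proper gcvx lsc sub0]) simp
  have x_step: "x (Suc k) = x k - \<alpha> k *\<^sub>R (gradf (x k) + w k)" for k
    by (simp add: w_def scaleR_right_distrib)
  have l_eq: "l k = norm (gradf (x (Suc k)) - gradf (x k)) / norm (x (Suc k) - x k)" for k
    by (simp add: l_def lip_est_def)

  \<comment> \<open>There may be no subgradient at \<open>x 0\<close>, so convergence is proved for the sequence started at \<open>x 1\<close>.\<close>
  interpret shifted: adaptive_prox "\<lambda>k. \<alpha> (Suc k)" "\<lambda>k. \<theta> (Suc k)" "\<lambda>k. l (Suc k)" f gradf g
    "\<lambda>k. x (Suc k)" w
    by unfold_locales (rule cvx der proper w_sub x_step l_eq steps.\<theta>_Suc steps.\<alpha>_Suc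
        steps.\<alpha>_pos steps.\<theta>_pos)+
  obtain z where "minimizes f g z" and z: "(\<lambda>k. x (Suc k)) \<longlonglongrightarrow> z"
    using shifted.converges[OF lsc lip min_xs0] by blast
  then have "is_arg_min F (\<lambda>_. True) z"
    unfolding F by (intro minimizes_is_arg_min[OF proper])
  moreover have "x \<longlonglongrightarrow> z" using z by (simp add: filterlim_sequentially_Suc)
  ultimately have part1: "\<exists>xs. is_arg_min F (\<lambda>_. True) xs \<and> x \<longlonglongrightarrow> xs" by blast

  have part2: "(\<forall>k\<ge>1. Min ((\<lambda>i. F (x i) - Fstar) ` {1..k}) \<le> ereal (R\<^sup>2 / (2 * (\<Sum>i=1..k. \<alpha> i)))) \<and>
       (\<alpha> 0 * lip_est gradf x 1 \<in> {1 / sqrt 2..2} \<longrightarrow>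
          (\<forall>L. L-lipschitz_on (cball xs R) gradf \<longrightarrow>
             (\<forall>k\<ge>1. Min ((\<lambda>i. F (x i) - Fstar) ` {1..k}) \<le> ereal (L * R\<^sup>2 / (sqrt 2 * real k)))))"
    if xs: "is_arg_min F (\<lambda>_. True) xs" and v: "v \<in> subdiff g (x 0)"
      and R: "R = sqrt ((norm (x 0 - xs))\<^sup>2 + 2 * (\<alpha> 0)\<^sup>2 * (norm (gradf (x 0) + v))\<^sup>2
                 + \<alpha> 0 * real_of_ereal (F (x 0) - Fstar))" for xs v R
  proof -
    \<comment> \<open>For the rate the sequence starts at \<open>x 0\<close>, with the given
      subgradient \<open>v\<close> put in front.\<close>
    define u where "u k = (case k of 0 \<Rightarrow> v | Suc j \<Rightarrow> w j)" for k
    have u_sub: "u k \<in> subdiff g (x k)" for k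
      using v w_sub by (cases k) (auto simp: u_def)
    have u_step: "x (Suc k) = x k - \<alpha> k *\<^sub>R (gradf (x k) + u (Suc k))" for k
      using x_step[of k] by (simp add: u_def)
    interpret adaptive_prox \<alpha> \<theta> l f gradf g x u
      by unfold_locales (rule cvx der proper u_sub u_step l_eq)+
    have mn: "minimizes f g xs"
      using is_arg_min_minimizes[OF proper dom0] xs unfolding F by blast
    have Fstar: "Fstar = F xs"
      unfolding assms(9) using xs by (intro INF_eqI) (auto simp: is_arg_min_def not_less)
    have gap: "F (x i) - Fstar = ereal (objective f g (x i) - objective f g xs)" for i
      using x_edom[of i] mn proper[of "x i"] proper[of xs] unfolding Fstar F minimizes_def
      by (cases "g (x i)"; cases "g xs") (auto simp: objective_def edom_def)
    have "R = sqrt (radius2 xs)"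
      unfolding R radius2_def gap by (simp add: \<theta>0 D_def u_def)
    moreover have "0 \<le> radius2 xs" using dist_le_radius2[OF mn, of 0] order_trans zero_le_power2 by blast
    ultimately have R2: "R\<^sup>2 = radius2 xs" and "0 \<le> R" by auto
    have rate: "Min ((\<lambda>i. F (x i) - Fstar) ` {1..k}) \<le> ereal (R\<^sup>2 / (2 * (\<Sum>i=1..k. \<alpha> i)))"
      if k: "k \<ge> 1" for k
    proof -
      define \<Delta> where "\<Delta> i = objective f g (x i) - objective f g xs" for i
      have fin: "finite (\<Delta> ` {1..k})" "\<Delta> ` {1..k} \<noteq> {}" using k by auto
      then obtain i where i: "i \<in> {1..k}" "\<Delta> i = Min (\<Delta> ` {1..k})"
        using Min_in[OF fin] unfolding image_iff by metis
      have "2 * \<Delta> i * (\<Sum>i=1..k. \<alpha> i) \<le> R\<^sup>2"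
        unfolding R2
      proof (rule weighted_gap_bound[OF mn k])
        show "0 \<le> \<Delta> i" using minimizer_le[OF mn] by (simp add: \<Delta>_def)
        show "\<Delta> i \<le> objective f g (x j) - objective f g xs" if "1 \<le> j" "j \<le> k" for j
          unfolding i(2) using that by (intro Min_le) (auto simp: \<Delta>_def)
      qed
      moreover have "0 < (\<Sum>i=1..k. \<alpha> i)" using k by (intro sum_pos) auto
      ultimately have "\<Delta> i \<le> R\<^sup>2 / (2 * (\<Sum>i=1..k. \<alpha> i))" by (simp add: le_divide_eq mult_ac)
      moreover have "Min ((\<lambda>i. F (x i) - Fstar) ` {1..k}) \<le> F (x i) - Fstar"
        using i(1) by (intro Min_le) auto
      ultimately show ?thesis unfolding gap \<Delta>_def by (meson ereal_less_eq(3) order_trans)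
    qed
    moreover have "Min ((\<lambda>i. F (x i) - Fstar) ` {1..k}) \<le> ereal (L * R\<^sup>2 / (sqrt 2 * real k))"
      if \<alpha>l: "\<alpha> 0 * lip_est gradf x 1 \<in> {1 / sqrt 2..2}" and L: "L-lipschitz_on (cball xs R) gradf"
        and k: "k \<ge> 1" for L k
    proof -
      have "norm (x j - xs) \<le> R" for j
        using dist_le_radius2[OF mn, of j] \<open>0 \<le> R\<close> unfolding R2[symmetric] by (rule power2_le_imp_le)
      then have ball: "x j \<in> cball xs R" for j by (simp add: dist_norm norm_minus_commute)
      have l_bound: "\<bar>l j\<bar> \<le> L" for j using l_le[OF L ball ball] l_nonneg[of j] by simp
      have l0: "1 / sqrt 2 \<le> \<alpha> 0 * l 0" "\<alpha> 0 * l 0 \<le> 2" using \<alpha>l by (auto simp: l_def)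
      \<comment> \<open>The lower bound on \<open>\<alpha> 0 * l 0\<close> makes \<open>L\<close>
        positive and then yields \<open>1 / (sqrt 2 * L) \<le> \<alpha> 0\<close>, the start for
        \<open>sum_steps_ge\<close>.\<close>
      have "0 < 1 / sqrt (2::real)" by simp
      then have "0 < \<alpha> 0 * l 0" using l0(1) by linarith
      then have Lpos: "0 < L" using l_bound[of 0] steps.\<alpha>_pos[of 0]
        by (smt (verit) mult_nonneg_nonpos)
      have "1 / sqrt 2 \<le> \<alpha> 0 * L"
        using l0(1) l_bound[of 0] by (smt (verit) mult_left_mono steps.steps_nonneg(1))
      then have "1 / (sqrt 2 * L) \<le> \<alpha> 0" using Lpos by (simp add: divide_le_eq mult_ac)
      then have sum: "real k * (1 / (sqrt 2 * L)) \<le> (\<Sum>i=1..k. \<alpha> i)"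
        using steps.sum_steps_ge[OF l_bound Lpos refl _ \<theta>0, of k] l0 \<open>0 < \<alpha> 0 * l 0\<close> by simp
      have "0 < real k * (1 / (sqrt 2 * L))" using k Lpos by simp
      then have "R\<^sup>2 / (2 * (\<Sum>i=1..k. \<alpha> i)) \<le> R\<^sup>2 / (2 * (real k * (1 / (sqrt 2 * L))))"
        using sum by (intro frac_le) auto
      also have "\<dots> = (sqrt 2 / 2) * (L * R\<^sup>2) / real k" by simp
      also have "\<dots> = L * R\<^sup>2 / (sqrt 2 * real k)"
        by (simp add: sqrt_divide_self_eq inverse_eq_divide)
      finally show ?thesis using rate[OF k] by (meson ereal_less_eq(3) order_trans)
    qed
    ultimately show ?thesis by blast
  qed
  show ?thesis using part1 part2 by blast
qed

end
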